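(* Let $a,b$ and $k$ be natural numbers and let $[k:\alpha]$ be a partition of $ab$ with $\alpha=(\alpha_1,\ldots,\alpha_t)$ and $t\leq k$. Let $n:=\sum_{j=2}^{t}\alpha_j$. Suppose that $k > n$ and $\alpha_1 < \frac{1}{2}(k-n)(k-n+1)$. Then $$\left\langle\phi^{(a^b)},\chi^{[k:\alpha]}\right\rangle=0.$$
   Context: Natural numbers are positive integers. For natural numbers $a,b$, let $\Omega^{(a^b)}$ be the collection of all set partitions of $\{1,2,\ldots,ab\}$ into $b$ sets each of size $a$; the symmetric group $S_{ab}$ acts on it. The Foulkes module $H^{(a^b)}$ is the corresponding $\mathbb{C}S_{ab}$-permutation module, and $\phi^{(a^b)}$ is its (permutation) character. For a partition $\lambda$ of $N$, $\chi^\lambda$ denotes the irreducible complex character of $S_N$ canonically labelled by $\lambda$, i.e. the character of the Specht module $S^\lambda$ (with $\chi^{(N)}$ trivial). $\langle\cdot,\cdot\rangle$ is the usual inner product of complex characters. Notation $[k:\alpha]$: let $\alpha=(\alpha_1,\ldots,\alpha_t)$ be a partition of a natural number $m$ (non-increasing positive parts), and let $k$ be a natural number such that $k\geq t$ and $ab-k-m\geq\alpha_1+1$. Then $[k:\alpha]$ is the partition $$(ab-k-m,\ \alpha_1+1,\ldots,\alpha_t+1,\ 1^{k-t})$$ of $ab$. *)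

theory Defs
  imports
    Complex_Main
    "HOL-Library.Function_Algebras"
    "HOL-Library.Disjoint_Sets"
    "HOL-Combinatorics.Permutations"
begin

section \<open>Permutation modules and traces over the complex numbers\<close>

text \<open>The permutation module on a set of points is the space of complex functions on the points,
  a point being identified with its indicator function.\<close>

global_interpretation cfun: vector_space "\<lambda>(c::complex) (f :: 'x \<Rightarrow> complex) x. c * f x"
  by unfold_locales (auto simp: fun_eq_iff algebra_simps)

definition point_vec :: "'x \<Rightarrow> 'x \<Rightarrow> complex" where
  "point_vec x = (\<lambda>y. if y = x then 1 else 0)"

definition perm_module :: "'x set \<Rightarrow> ('x \<Rightarrow> complex) set" where
  "perm_module X = cfun.span (point_vec ` X)"

text \<open>Linear extension of an action on points: \<open>g\<close> sends \<open>point_vec x\<close> to \<open>point_vec (act g x)\<close>,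
  hence the inverse below.\<close>

definition lin_action ::
    "((nat \<Rightarrow> nat) \<Rightarrow> 'x \<Rightarrow> 'x) \<Rightarrow> (nat \<Rightarrow> nat) \<Rightarrow> ('x \<Rightarrow> complex) \<Rightarrow> ('x \<Rightarrow> complex)" where
  "lin_action act g f = (\<lambda>x. f (act (inv g) x))"

text \<open>Trace of a linear endomorphism \<open>T\<close> of a finite-dimensional subspace \<open>V\<close>; by
  \<open>lin_trace_eq\<close> below the choice of the basis is irrelevant.\<close>

definition lin_trace :: "('x \<Rightarrow> complex) set \<Rightarrow> (('x \<Rightarrow> complex) \<Rightarrow> ('x \<Rightarrow> complex)) \<Rightarrow> complex" where
  "lin_trace V T =
    (let B = (SOME B. B \<subseteq> V \<and> cfun.independent B \<and> V \<subseteq> cfun.span B)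
     in \<Sum>v\<in>B. cfun.representation B (T v) v)"

lemma basis_change_trace:
  fixes T :: "('x \<Rightarrow> complex) \<Rightarrow> ('x \<Rightarrow> complex)"
  assumes B: "finite B" "cfun.independent B" "cfun.span B = V"
    and C: "finite C" "cfun.independent C" "cfun.span C = V"
    and add: "\<And>f g. f \<in> V \<Longrightarrow> g \<in> V \<Longrightarrow> T (f + g) = T f + T g"
    and scale: "\<And>c f. f \<in> V \<Longrightarrow> T (\<lambda>x. c * f x) = (\<lambda>x. c * T f x)"
    and inv: "\<And>f. f \<in> V \<Longrightarrow> T f \<in> V"
  shows "(\<Sum>v\<in>B. cfun.representation B (T v) v) = (\<Sum>v\<in>C. cfun.representation C (T v) v)"
proof -
  let ?s = "\<lambda>(c::complex) (f :: 'x \<Rightarrow> complex) x. c * f x"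
  let ?rB = "cfun.representation B" and ?rC = "cfun.representation C"
  have subV: "cfun.subspace V" using B(3) cfun.subspace_span by metis
  have BV: "v \<in> V" if "v \<in> B" for v using that B(3) cfun.span_base by metis
  have CV: "v \<in> V" if "v \<in> C" for v using that C(3) cfun.span_base by metis
  have T_sum: "T (\<Sum>i\<in>I. ?s (c i) (f i)) = (\<Sum>i\<in>I. ?s (c i) (T (f i)))"
    if "finite I" "\<And>i. i \<in> I \<Longrightarrow> f i \<in> V" for I :: "('x \<Rightarrow> complex) set" and c f
    using that
  proof (induction I rule: finite_induct)
    case empty
    have "T 0 = 0"
      using scale[of 0 0] cfun.subspace_0[OF subV] by (simp add: zero_fun_def)
    then show ?case by (simp only: sum.empty)
  next
    case (insert i I)
    have "(\<Sum>i\<in>I. ?s (c i) (f i)) \<in> V"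
      using insert.prems by (intro cfun.subspace_sum[OF subV] cfun.subspace_scale[OF subV]) auto
    moreover have "?s (c i) (f i) \<in> V"
      using insert.prems by (intro cfun.subspace_scale[OF subV]) auto
    ultimately have "T (?s (c i) (f i) + (\<Sum>i\<in>I. ?s (c i) (f i))) =
        T (?s (c i) (f i)) + T (\<Sum>i\<in>I. ?s (c i) (f i))"
      by (rule add[rotated])
    moreover have "T (?s (c i) (f i)) = ?s (c i) (T (f i))"
      using insert.prems by (intro scale) auto
    moreover have "T (\<Sum>i\<in>I. ?s (c i) (f i)) = (\<Sum>i\<in>I. ?s (c i) (T (f i)))"
      using insert.prems by (intro insert.IH) auto
    ultimately show ?case
      by (simp only: sum.insert[OF insert.hyps])
  qed
  have expC: "(\<Sum>w\<in>C. ?s (?rC u w) w) = u" if "u \<in> V" for u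
    using cfun.sum_representation_eq[of C u C] C that by auto
  have expB: "(\<Sum>w\<in>B. ?s (?rB u w) w) = u" if "u \<in> V" for u
    using cfun.sum_representation_eq[of B u B] B that by auto
  have rB_sum: "?rB (\<Sum>i\<in>I. ?s (c i) (f i)) v = (\<Sum>i\<in>I. c i * ?rB (f i) v)"
    if "finite I" "\<And>i. i \<in> I \<Longrightarrow> f i \<in> V" for I :: "('x \<Rightarrow> complex) set" and c f v
    using that B
    by (subst cfun.representation_sum)
       (auto intro!: cfun.span_scale sum.cong simp: cfun.representation_scale)
  have rC_sum: "?rC (\<Sum>i\<in>I. ?s (c i) (f i)) v = (\<Sum>i\<in>I. c i * ?rC (f i) v)"
    if "finite I" "\<And>i. i \<in> I \<Longrightarrow> f i \<in> V" for I :: "('x \<Rightarrow> complex) set" and c f v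
    using that C
    by (subst cfun.representation_sum)
       (auto intro!: cfun.span_scale sum.cong simp: cfun.representation_scale)
  have "(\<Sum>v\<in>B. ?rB (T v) v) = (\<Sum>v\<in>B. \<Sum>w\<in>C. ?rC v w * ?rB (T w) v)"
  proof (rule sum.cong[OF refl])
    fix v assume v: "v \<in> B"
    have "?rB (T v) v = ?rB (T (\<Sum>w\<in>C. ?s (?rC v w) w)) v" using expC BV v by simp
    also have "\<dots> = ?rB (\<Sum>w\<in>C. ?s (?rC v w) (T w)) v" using T_sum C CV by simp
    also have "\<dots> = (\<Sum>w\<in>C. ?rC v w * ?rB (T w) v)" using C CV inv by (subst rB_sum) auto
    finally show "?rB (T v) v = \<dots>" .
  qed
  also have "\<dots> = (\<Sum>w\<in>C. \<Sum>v\<in>B. ?rB (T w) v * ?rC v w)"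
    by (subst sum.swap) (simp add: mult.commute)
  also have "\<dots> = (\<Sum>w\<in>C. ?rC (T w) w)"
  proof (rule sum.cong[OF refl])
    fix w assume w: "w \<in> C"
    have "(\<Sum>v\<in>B. ?rB (T w) v * ?rC v w) = ?rC (\<Sum>v\<in>B. ?s (?rB (T w) v) v) w"
      using B BV by (subst rC_sum) auto
    then show "(\<Sum>v\<in>B. ?rB (T w) v * ?rC v w) = ?rC (T w) w"
      using expB inv CV w by simp
  qed
  finally show ?thesis .
qed

lemma lin_trace_eq:
  assumes B: "finite B" "cfun.independent B" "cfun.span B = V"
    and "\<And>f g. f \<in> V \<Longrightarrow> g \<in> V \<Longrightarrow> T (f + g) = T f + T g"
    and "\<And>c f. f \<in> V \<Longrightarrow> T (\<lambda>x. c * f x) = (\<lambda>x. c * T f x)"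
    and "\<And>f. f \<in> V \<Longrightarrow> T f \<in> V"
  shows "lin_trace V T = (\<Sum>v\<in>B. cfun.representation B (T v) v)"
proof -
  define C where "C = (SOME B. B \<subseteq> V \<and> cfun.independent B \<and> V \<subseteq> cfun.span B)"
  have "B \<subseteq> V" using B(3) cfun.span_superset by metis
  then have "\<exists>B. B \<subseteq> V \<and> cfun.independent B \<and> V \<subseteq> cfun.span B"
    using B by (intro exI[of _ B]) auto
  then have C: "C \<subseteq> V \<and> cfun.independent C \<and> V \<subseteq> cfun.span C"
    unfolding C_def by (rule someI_ex)
  have sub: "cfun.subspace V" using B(3) cfun.subspace_span by metis
  have "cfun.span C = V" using C cfun.span_minimal[OF _ sub] by blast
  moreover have "finite C"
    using cfun.independent_span_bound[OF B(1), of C] C B(3) by auto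
  moreover have "cfun.independent C" using C by blast
  ultimately have "(\<Sum>v\<in>C. cfun.representation C (T v) v) = (\<Sum>v\<in>B. cfun.representation B (T v) v)"
    by (intro basis_change_trace[of C V B T] B assms(4-6))
  then show ?thesis
    unfolding lin_trace_def Let_def C_def[symmetric] .
qed


section \<open>The Foulkes character\<close>

text \<open>\<open>S\<^sub>N\<close> is rendered as \<open>{g. g permutes {1..N}}\<close>.\<close>

definition set_parts :: "nat \<Rightarrow> nat \<Rightarrow> nat set set set" where
  "set_parts a b = {P. partition_on {1..a * b} P \<and> card P = b \<and> (\<forall>X\<in>P. card X = a)}"

definition foulkes_module :: "nat \<Rightarrow> nat \<Rightarrow> (nat set set \<Rightarrow> complex) set" where
  "foulkes_module a b = perm_module (set_parts a b)"

definition foulkes_char :: "nat \<Rightarrow> nat \<Rightarrow> (nat \<Rightarrow> nat) \<Rightarrow> complex" where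
  "foulkes_char a b g = lin_trace (foulkes_module a b) (lin_action (\<lambda>g P. (`) g ` P) g)"


section \<open>Specht modules and their characters\<close>

definition int_partition :: "nat \<Rightarrow> nat list \<Rightarrow> bool" where
  "int_partition N lam \<longleftrightarrow> sorted_wrt (\<ge>) lam \<and> (\<forall>x\<in>set lam. x > 0) \<and> sum_list lam = N"

definition diagram :: "nat list \<Rightarrow> (nat \<times> nat) set" where
  "diagram lam = {(i, j). i < length lam \<and> j < lam ! i}"

definition tableau :: "nat list \<Rightarrow> (nat \<times> nat \<Rightarrow> nat) \<Rightarrow> bool" where
  "tableau lam t \<longleftrightarrow> bij_betw t (diagram lam) {1..sum_list lam}"

text \<open>A tabloid, i.e. a row equivalence class of tableaux, is given by the sets of entries of
  its rows.\<close>

definition tabloid :: "nat list \<Rightarrow> (nat \<times> nat \<Rightarrow> nat) \<Rightarrow> (nat \<Rightarrow> nat set)" where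
  "tabloid lam t = (\<lambda>i. t ` {(i', j) \<in> diagram lam. i' = i})"

definition column_stabilizer :: "nat list \<Rightarrow> (nat \<times> nat \<Rightarrow> nat) \<Rightarrow> (nat \<Rightarrow> nat) set" where
  "column_stabilizer lam t =
    {p. p permutes {1..sum_list lam} \<and>
        (\<forall>j. let col = t ` {(i, j') \<in> diagram lam. j' = j} in p ` col = col)}"

definition polytabloid :: "nat list \<Rightarrow> (nat \<times> nat \<Rightarrow> nat) \<Rightarrow> (nat \<Rightarrow> nat set) \<Rightarrow> complex" where
  "polytabloid lam t =
    (\<Sum>p\<in>column_stabilizer lam t. (\<lambda>x. of_int (sign p) * point_vec (tabloid lam (p \<circ> t)) x))"

definition specht_module :: "nat list \<Rightarrow> ((nat \<Rightarrow> nat set) \<Rightarrow> complex) set" where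
  "specht_module lam = cfun.span {polytabloid lam t |t. tableau lam t}"

definition specht_char :: "nat list \<Rightarrow> (nat \<Rightarrow> nat) \<Rightarrow> complex" where
  "specht_char lam g = lin_trace (specht_module lam) (lin_action (\<lambda>g x i. g ` x i) g)"


section \<open>Inner product of characters\<close>

definition char_inner :: "nat \<Rightarrow> ((nat \<Rightarrow> nat) \<Rightarrow> complex) \<Rightarrow> ((nat \<Rightarrow> nat) \<Rightarrow> complex) \<Rightarrow> complex" where
  "char_inner N \<phi> \<chi> = (\<Sum>g | g permutes {1..N}. \<phi> g * cnj (\<chi> g)) / of_nat (fact N)"


section \<open>The partition \<open>[k : \<alpha>]\<close>\<close>

definition bracket_partition :: "nat \<Rightarrow> nat \<Rightarrow> nat \<Rightarrow> nat list \<Rightarrow> nat list" where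
  "bracket_partition a b k \<alpha> =
    (a * b - k - sum_list \<alpha>) # map (\<lambda>x. x + 1) \<alpha> @ replicate (k - length \<alpha>) 1"

lemma int_partition_bracket_partition:
  assumes \<alpha>: "int_partition m \<alpha>" "\<alpha> \<noteq> []"
    and k: "length \<alpha> \<le> k" and ab: "k + m + (hd \<alpha> + 1) \<le> a * b"
  shows "int_partition (a * b) (bracket_partition a b k \<alpha>)"
proof -
  define h where "h = a * b - k - m"
  have m: "sum_list \<alpha> = m" using \<alpha> by (simp add: int_partition_def)
  have h: "hd \<alpha> + 1 \<le> h" "h + k + m = a * b" using ab unfolding h_def by linarith+
  have le: "x + 1 \<le> h" if "x \<in> set \<alpha>" for x
  proof -
    have "x \<le> hd \<alpha>" using that \<alpha> by (cases \<alpha>) (auto simp: int_partition_def)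
    then show ?thesis using h by linarith
  qed
  have rep: "sorted_wrt (\<ge>) (replicate r (1::nat))" for r
    by (induction r) auto
  have "sum_list (map (\<lambda>x. x + 1) xs) = sum_list xs + length xs" for xs :: "nat list"
    by (induction xs) auto
  then have sum: "sum_list (h # map (\<lambda>x. x + 1) \<alpha> @ replicate (k - length \<alpha>) 1) = a * b"
    using m h k by (simp add: sum_list_replicate)
  have "sorted_wrt (\<ge>) (map (\<lambda>x. x + 1) \<alpha> @ replicate (k - length \<alpha>) 1)"
    unfolding sorted_wrt_append using rep \<alpha>(1) by (auto simp: int_partition_def sorted_wrt_map)
  moreover have "x \<le> h" if "x \<in> set (map (\<lambda>x. x + 1) \<alpha> @ replicate (k - length \<alpha>) 1)" for x
    using that le h(1) by fastforce
  ultimately have sorted: "sorted_wrt (\<ge>) (h # map (\<lambda>x. x + 1) \<alpha> @ replicate (k - length \<alpha>) 1)"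
    by simp
  have pos: "\<forall>x\<in>set (h # map (\<lambda>x. x + 1) \<alpha> @ replicate (k - length \<alpha>) 1). x > 0"
    using h(1) by auto
  show ?thesis
    unfolding int_partition_def bracket_partition_def m h_def[symmetric]
    using sum sorted pos by blast
qed

end

theory Submission
  imports Defs
begin

text \<open>The character of the Foulkes module counts fixed set partitions, so the inner product vanishes once
  the sum over the stabilizer of every set partition \<open>P\<close> kills the Specht module. Fix a tableau and
  symmetrize its polytabloid over the permutations preserving rows \<open>0\<close> and \<open>1\<close> outside the first column.
  The result still changes sign under odd permutations of the first column. If no block of \<open>P\<close>
  contains two entries of the first column, at least \<open>k + 1 - n\<close> blocks contain exactly one and otherwise
  only entries of rows \<open>0\<close> and \<open>1\<close>; the bound on \<open>\<alpha>\<^sub>1\<close> forces two of them to contain equally many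
  entries of row \<open>1\<close>. In either case an odd permutation of the first column, corrected by one of the
  symmetrizing permutations, stabilizes \<open>P\<close>, so the stabilizer sum kills the symmetrized
  polytabloid. Antisymmetrizing the latter over the column stabilizer gives back a positive multiple
  of the polytabloid.\<close>

declare One_nat_def [simp del]

section \<open>Sums over finite groups of permutations\<close>

definition perm_group :: "('a \<Rightarrow> 'a) set \<Rightarrow> bool" where
  "perm_group K \<longleftrightarrow> finite K \<and> id \<in> K \<and> (\<forall>p\<in>K. bij p) \<and> (\<forall>p\<in>K. \<forall>q\<in>K. p \<circ> q \<in> K)
     \<and> (\<forall>p\<in>K. inv p \<in> K)"

lemma perm_group_permutes:
  assumes "finite S" and "Q id"
    and "\<And>p q. p permutes S \<Longrightarrow> q permutes S \<Longrightarrow> Q p \<Longrightarrow> Q q \<Longrightarrow> Q (p \<circ> q)"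
    and "\<And>p. p permutes S \<Longrightarrow> Q p \<Longrightarrow> Q (inv p)"
  shows "perm_group {p. p permutes S \<and> Q p}"
  unfolding perm_group_def using assms
  by (auto intro: permutes_id permutes_compose permutes_inv permutes_bij
      finite_subset[OF _ finite_permutations[OF \<open>finite S\<close>]])

lemma sum_perm_group_left:
  assumes "perm_group K" and "u \<in> K"
  shows "(\<Sum>q\<in>K. f (u \<circ> q)) = (\<Sum>q\<in>K. f q)"
proof -
  have "bij u" using assms by (auto simp: perm_group_def)
  then have "inv u \<circ> (u \<circ> q) = q" "u \<circ> (inv u \<circ> q) = q" for q
    by (auto simp: fun_eq_iff bij_is_inj bij_is_surj surj_f_inv_f)
  then show ?thesis
    using assms by (intro sum.reindex_bij_witness[where i = "\<lambda>q. inv u \<circ> q" and j = "\<lambda>q. u \<circ> q"])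
      (auto simp: perm_group_def)
qed

lemma sum_perm_group_right:
  assumes "perm_group K" and "u \<in> K"
  shows "(\<Sum>q\<in>K. f (q \<circ> u)) = (\<Sum>q\<in>K. f q)"
proof -
  have "bij u" using assms by (auto simp: perm_group_def)
  then have "(q \<circ> u) \<circ> inv u = q" "(q \<circ> inv u) \<circ> u = q" for q
    by (auto simp: fun_eq_iff bij_is_inj bij_is_surj surj_f_inv_f)
  then show ?thesis
    using assms by (intro sum.reindex_bij_witness[where i = "\<lambda>q. q \<circ> inv u" and j = "\<lambda>q. q \<circ> u"])
      (auto simp: perm_group_def)
qed

lemma sum_perm_group_inv:
  assumes "perm_group K"
  shows "(\<Sum>q\<in>K. f (inv q)) = (\<Sum>q\<in>K. f q)"
  using assms by (intro sum.reindex_bij_witness[where i = inv and j = inv])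
    (auto simp: perm_group_def inv_inv_eq)

lemma sign_compose_permutes:
  assumes "finite S" and "p permutes S" and "q permutes S"
  shows "sign (p \<circ> q) = sign p * sign q"
  using assms by (intro sign_compose) (auto simp: permutation_permutes)

section \<open>Sums of distinct natural numbers\<close>

text \<open>With \<open>m = card S\<close>, the sets \<open>S - {..<m}\<close> and
  \<open>{..<m} - S\<close> have equal size. The elements of the former are at least
  \<open>m\<close>, those of the latter at most \<open>m - 1\<close>, so equal sums leave nothing
  outside the common part.\<close>

lemma sum_ge_sum_lessThan_card:
  fixes S :: "nat set"
  assumes "finite S"
  shows "\<Sum>{..<card S} \<le> \<Sum>S" and "\<Sum>{..<card S} = \<Sum>S \<Longrightarrow> S = {..<card S}"
proof -
  define m where "m = card S"
  define d where "d = card (S - {..<m})"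
  have fin: "finite (S - {..<m})" using assms by simp
  have S: "\<Sum>S = \<Sum>(S \<inter> {..<m}) + \<Sum>(S - {..<m})"
    using assms by (subst sum.union_disjoint[symmetric]) (auto intro!: sum.cong)
  have M: "\<Sum>{..<m} = \<Sum>(S \<inter> {..<m}) + \<Sum>({..<m} - S)"
    by (subst sum.union_disjoint[symmetric]) (auto intro!: sum.cong)
  have "card S = card (S \<inter> {..<m}) + d"
    unfolding d_def using assms by (rule card_Int_Diff)
  moreover have "card {..<m} = card (S \<inter> {..<m}) + card ({..<m} - S)"
    using card_Int_Diff[of "{..<m}" S] by (simp add: Int_commute)
  ultimately have d: "card ({..<m} - S) = d" by (simp add: m_def)
  have lo: "d * m \<le> \<Sum>(S - {..<m})"
    using sum_bounded_below[of "S - {..<m}" m "\<lambda>x. x"] by (simp add: d_def)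
  have hi: "\<Sum>({..<m} - S) \<le> d * (m - 1)"
    using sum_bounded_above[of "{..<m} - S" "\<lambda>x. x" "m - 1"] d by fastforce
  have "d * (m - 1) \<le> d * m" by simp
  then show "\<Sum>{..<card S} \<le> \<Sum>S" using S M lo hi unfolding m_def[symmetric] by linarith
  assume "\<Sum>{..<card S} = \<Sum>S"
  then have "d * m \<le> d * (m - 1)" using S M lo hi unfolding m_def[symmetric] by linarith
  \<comment> \<open>For \<open>m = 0\<close> truncated subtraction gives \<open>m - 1 = m\<close>
    and the comparison says nothing about \<open>d\<close>; in that case \<open>S\<close> is
    empty.\<close>
  then have "d = 0 \<or> m = 0" by (cases m) auto
  moreover have "m = 0 \<Longrightarrow> S = {}" using assms m_def by auto
  ultimately have "S \<subseteq> {..<m}" using fin d_def by auto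
  then have "S = {..<m}" by (intro card_subset_eq) (simp_all add: m_def)
  then show "S = {..<card S}" unfolding m_def .
qed

lemma sum_inj_ge_triangle:
  fixes f :: "'a \<Rightarrow> nat"
  assumes "finite S" and "inj_on f S"
  shows "\<Sum>{..<card S} \<le> (\<Sum>x\<in>S. f x)"
    and "\<Sum>{..<card S} = (\<Sum>x\<in>S. f x) \<Longrightarrow> f ` S = {..<card S}"
  using sum_ge_sum_lessThan_card[of "f ` S"] assms
  by (simp_all add: sum.reindex card_image)

lemma down_closed_eq_lessThan:
  fixes S :: "nat set"
  assumes "finite S" and "\<And>i j. i \<in> S \<Longrightarrow> j < i \<Longrightarrow> j \<in> S"
  shows "S = {..<card S}"
proof (cases "S = {}")
  case False
  then have "Max S \<in> S" using assms(1) Max_in by blast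
  then have "S = {..Max S}"
    using assms(2)[OF \<open>Max S \<in> S\<close>] Max_ge[OF assms(1)] by (auto simp: le_less)
  then have "S = {..<Suc (Max S)}" by (simp only: lessThan_Suc_atMost)
  then show ?thesis by (metis card_lessThan)
qed simp

section \<open>Swapping two sets\<close>

text \<open>A bijection from \<open>S\<close> to \<open>T\<close> is glued to its inverse;
  injectivity on the union then follows by counting.\<close>

lemma ex_swap_permutes:
  assumes "finite S" and "finite T" and "card S = card T" and disj: "S \<inter> T = {}"
  shows "\<exists>u. u permutes (S \<union> T) \<and> u ` S = T \<and> u ` T = S"
proof -
  obtain f where f: "bij_betw f S T"
    using finite_same_card_bij assms by blast
  define g where "g = inv_into S f"
  have g: "bij_betw g T S" using f unfolding g_def by (rule bij_betw_inv_into)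
  define u where "u = (\<lambda>x. if x \<in> S then f x else if x \<in> T then g x else x)"
  have uS: "u ` S = T" using f by (auto simp: u_def bij_betw_def)
  have "u ` T = g ` T" using disj by (auto simp: u_def)
  then have uT: "u ` T = S" using g by (simp add: bij_betw_def)
  have "inj_on u (S \<union> T)"
    by (rule eq_card_imp_inj_on) (use assms uS uT in \<open>auto simp: image_Un Un_commute\<close>)
  then have "bij_betw u (S \<union> T) (S \<union> T)"
    using uS uT by (auto simp: bij_betw_def)
  then have "u permutes (S \<union> T)" by (intro bij_imp_permutes) (auto simp: u_def)
  then show ?thesis using uS uT by blast
qed

section \<open>The action on tabloids\<close>

text \<open>This is the renaming of entries whose linear extension defines
  \<open>specht_char\<close>.\<close>

definition tmap :: "('a \<Rightarrow> 'a) \<Rightarrow> ('i \<Rightarrow> 'a set) \<Rightarrow> 'i \<Rightarrow> 'a set" where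
  "tmap g x = (\<lambda>i. g ` x i)"

lemma tmap_comp: "tmap (g \<circ> h) x = tmap g (tmap h x)"
  by (simp add: tmap_def image_comp)

lemma tmap_id [simp]: "tmap id x = x"
  by (simp add: tmap_def)

lemma tmap_inv: "bij g \<Longrightarrow> tmap (inv g) (tmap g x) = x" "bij g \<Longrightarrow> tmap g (tmap (inv g) x) = x"
  by (simp_all add: tmap_comp[symmetric] bij_is_inj bij_is_surj surj_iff[THEN iffD1])

lemma tmap_inj: "bij g \<Longrightarrow> tmap g x = tmap g y \<longleftrightarrow> x = y"
  by (metis tmap_inv(1))

lemma tabloid_comp: "tabloid lam (g \<circ> t) = tmap g (tabloid lam t)"
  by (simp add: tabloid_def tmap_def image_comp)

lemma sum_fun_apply: "(\<Sum>i\<in>I. h i) x = (\<Sum>i\<in>I. h i x)"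
  for h :: "'i \<Rightarrow> 'x \<Rightarrow> complex"
  by (induction I rule: infinite_finite_induct) auto

lemma polytabloid_apply:
  "polytabloid lam t x =
    (\<Sum>p\<in>column_stabilizer lam t. of_int (sign p) * (if x = tmap p (tabloid lam t) then 1 else 0))"
  by (simp add: polytabloid_def sum_fun_apply tabloid_comp point_vec_def)

lemma finite_diagram: "finite (diagram lam)"
proof -
  have "diagram lam = (SIGMA i:{..<length lam}. {..<lam ! i})" by (auto simp: diagram_def)
  then show ?thesis by simp
qed

section \<open>Rows and columns of a fixed tableau\<close>

locale young_tableau =
  fixes lam :: "nat list" and t :: "nat \<times> nat \<Rightarrow> nat" and N :: nat
  assumes part: "int_partition N lam" and tab: "tableau lam t"
begin

text \<open>Entries are located by inverting the filling. Numbering starts at 0, and outside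
  \<open>{1..N}\<close> the values are unspecified.\<close>

definition row :: "nat \<Rightarrow> nat" where "row x = fst (inv_into (diagram lam) t x)"
definition col :: "nat \<Rightarrow> nat" where "col x = snd (inv_into (diagram lam) t x)"

lemma sum_lam: "sum_list lam = N"
  using part by (simp add: int_partition_def)

lemma bij_t: "bij_betw t (diagram lam) {1..N}"
  using tab by (simp add: tableau_def sum_lam)

lemma cell_in: "x \<in> {1..N} \<Longrightarrow> (row x, col x) \<in> diagram lam"
  using bij_t by (auto simp: row_def col_def bij_betw_def intro: inv_into_into)

lemma t_cell: "x \<in> {1..N} \<Longrightarrow> t (row x, col x) = x"
  using bij_t by (auto simp: row_def col_def bij_betw_def f_inv_into_f)

lemma t_in: "c \<in> diagram lam \<Longrightarrow> t c \<in> {1..N}"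
  using bij_t by (auto simp: bij_betw_def)

lemma row_t: "c \<in> diagram lam \<Longrightarrow> row (t c) = fst c"
  and col_t: "c \<in> diagram lam \<Longrightarrow> col (t c) = snd c"
  using bij_t by (auto simp: row_def col_def bij_betw_def)

lemma cell_eqI: "x \<in> {1..N} \<Longrightarrow> y \<in> {1..N} \<Longrightarrow> row x = row y \<Longrightarrow> col x = col y \<Longrightarrow> x = y"
  using t_cell by metis

lemma image_t_cells: "t ` {c \<in> diagram lam. Q (fst c) (snd c)} = {x \<in> {1..N}. Q (row x) (col x)}"
  (is "?L = ?R")
proof
  show "?L \<subseteq> ?R" using t_in row_t col_t by auto
  show "?R \<subseteq> ?L"
  proof
    fix x assume x: "x \<in> ?R"
    then have "(row x, col x) \<in> {c \<in> diagram lam. Q (fst c) (snd c)}" using cell_in by auto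
    then show "x \<in> ?L" using t_cell x by (metis (mono_tags, lifting) imageI mem_Collect_eq)
  qed
qed

lemma card_cells: "card {x \<in> {1..N}. Q (row x) (col x)} = card {c \<in> diagram lam. Q (fst c) (snd c)}"
  unfolding image_t_cells[symmetric] using bij_t
  by (intro card_image) (auto simp: bij_betw_def inj_on_def)

definition T :: "nat \<Rightarrow> nat set" where "T = tabloid lam t"

lemma T_eq: "T i = {x \<in> {1..N}. row x = i}"
proof -
  have "{(i', j) \<in> diagram lam. i' = i} = {c \<in> diagram lam. fst c = i}" by auto
  then show ?thesis using image_t_cells[of "\<lambda>r c. r = i"] by (simp add: T_def tabloid_def)
qed

text \<open>Every tabloid of the shape has the form \<open>tmap g T\<close>, and
  \<open>row (inv g x)\<close> is the row in which it holds \<open>x\<close>. Statements about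
  arbitrary tabloids are reduced to \<open>row\<close> in this way.\<close>

lemma tmap_T:
  assumes "g permutes {1..N}"
  shows "tmap g T i = {x \<in> {1..N}. row (inv g x) = i}"
proof -
  have "x \<in> g ` {x \<in> {1..N}. row x = i} \<longleftrightarrow> x \<in> {1..N} \<and> row (inv g x) = i" for x
  proof
    assume "x \<in> g ` {x \<in> {1..N}. row x = i}"
    then show "x \<in> {1..N} \<and> row (inv g x) = i"
      using assms permutes_in_image[OF assms] permutes_inverses[OF assms] by auto
  next
    assume x: "x \<in> {1..N} \<and> row (inv g x) = i"
    then have "inv g x \<in> {1..N}" using permutes_in_image[OF permutes_inv[OF assms]] by blast
    then show "x \<in> g ` {x \<in> {1..N}. row x = i}"
      using x permutes_inverses[OF assms] by (intro image_eqI[of _ _ "inv g x"]) auto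
  qed
  then show ?thesis unfolding tmap_def T_eq by blast
qed

section \<open>The column group and the coefficients of the polytabloid\<close>

definition C :: "(nat \<Rightarrow> nat) set" where
  "C = {p. p permutes {1..N} \<and> (\<forall>x\<in>{1..N}. col (p x) = col x)}"

lemma column_stabilizer_eq: "column_stabilizer lam t = C"
proof -
  have col: "t ` {(i, j') \<in> diagram lam. j' = j} = {x \<in> {1..N}. col x = j}" for j
  proof -
    have "{(i, j') \<in> diagram lam. j' = j} = {c \<in> diagram lam. snd c = j}" by auto
    then show ?thesis using image_t_cells[of "\<lambda>r c. c = j"] by simp
  qed
  have "(\<forall>j. p ` {x \<in> {1..N}. col x = j} = {x \<in> {1..N}. col x = j}) \<longleftrightarrow>
      (\<forall>x\<in>{1..N}. col (p x) = col x)" (is "?L = ?R") if p: "p permutes {1..N}" for p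
  proof
    assume ?L
    show ?R
    proof
      fix x assume "x \<in> {1..N}"
      then have "p x \<in> p ` {y \<in> {1..N}. col y = col x}" by auto
      then show "col (p x) = col x" using \<open>?L\<close> by auto
    qed
  next
    assume R: ?R
    have "p ` {x \<in> {1..N}. col x = j} \<subseteq> {x \<in> {1..N}. col x = j}" for j
      using R permutes_in_image[OF p] by auto
    then show ?L
      using p by (intro allI card_subset_eq) (auto simp: card_image permutes_inj_on)
  qed
  then show ?thesis by (auto simp: column_stabilizer_def C_def col sum_lam Let_def)
qed

lemma C_permutes: "p \<in> C \<Longrightarrow> p permutes {1..N}"
  by (simp add: C_def)

lemma C_bij: "p \<in> C \<Longrightarrow> bij p"
  by (auto simp: C_def permutes_bij)

lemma C_group: "perm_group C"
  unfolding C_def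
proof (rule perm_group_permutes)
  fix p assume p: "p permutes {1..N}" "\<forall>x\<in>{1..N}. col (p x) = col x"
  show "\<forall>x\<in>{1..N}. col (inv p x) = col x"
  proof
    fix x assume "x \<in> {1..N}"
    then have "inv p x \<in> {1..N}" using permutes_in_image[OF permutes_inv[OF p(1)]] by blast
    then have "col (p (inv p x)) = col (inv p x)" using p(2) by blast
    then show "col (inv p x) = col x" using permutes_inverses(1)[OF p(1)] by simp
  qed
next
  fix p q assume "p permutes {1..N}" and q: "q permutes {1..N}"
    and *: "\<forall>x\<in>{1..N}. col (p x) = col x" "\<forall>x\<in>{1..N}. col (q x) = col x"
  show "\<forall>x\<in>{1..N}. col ((p \<circ> q) x) = col x"
    using * permutes_in_image[OF q] by (auto simp del: atLeastAtMost_iff)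
qed auto

lemma sign_C: "p \<in> C \<Longrightarrow> q \<in> C \<Longrightarrow> sign (p \<circ> q) = sign p * sign q"
  by (rule sign_compose_permutes[of "{1..N}"]) (auto simp: C_def)

text \<open>This is the polytabloid of \<open>t\<close> as an integer-valued function. Integers keep
  the order available for the positivity argument about \<open>kap\<close>.\<close>

definition alt :: "(nat \<Rightarrow> nat set) \<Rightarrow> int" where
  "alt x = (\<Sum>p\<in>C. sign p * (if x = tmap p T then 1 else 0))"

lemma polytabloid_eq: "polytabloid lam t x = of_int (alt x)"
  by (simp add: polytabloid_apply alt_def column_stabilizer_eq T_def if_distrib cong: if_cong)

lemma alt_tmap:
  assumes u: "u \<in> C"
  shows "alt (tmap u x) = sign u * alt x"
proof -
  have "alt (tmap u x) = (\<Sum>p\<in>C. sign (u \<circ> p) * (if tmap u x = tmap (u \<circ> p) T then 1 else 0))"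
    unfolding alt_def by (rule sum_perm_group_left[OF C_group u, symmetric])
  also have "\<dots> = (\<Sum>p\<in>C. sign u * (sign p * (if x = tmap p T then 1 else 0)))"
    by (intro sum.cong refl) (simp add: sign_C u tmap_comp tmap_inj C_bij)
  finally show ?thesis by (simp add: alt_def sum_distrib_left)
qed

text \<open>Such a permutation preserves both the row and the column of every entry, and these
  determine the entry.\<close>

lemma C_fixing_T:
  assumes "p \<in> C" and "tmap p T = T"
  shows "p = id"
proof
  fix x
  have p: "p permutes {1..N}" using assms C_permutes by blast
  show "p x = id x"
  proof (cases "x \<in> {1..N}")
    case True
    then have "p x \<in> tmap p T (row x)" by (auto simp: tmap_def T_eq)
    then have "p x \<in> T (row x)" using assms by simp
    then have "row (p x) = row x" "p x \<in> {1..N}" by (auto simp: T_eq)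
    moreover have "col (p x) = col x" using assms True by (auto simp: C_def)
    ultimately show ?thesis using cell_eqI[of "p x" x] True by simp
  next
    case False
    then show ?thesis using p by (simp add: permutes_def)
  qed
qed

lemma alt_T: "alt T = 1"
proof -
  have "T = tmap p T \<longleftrightarrow> p = id" if "p \<in> C" for p
    using C_fixing_T that by auto
  then have "alt T = (\<Sum>p\<in>C. if p = id then 1 else 0)"
    unfolding alt_def by (intro sum.cong) (auto simp: sign_id)
  then show ?thesis using C_group by (simp add: perm_group_def)
qed

lemma alt_support: "alt x \<noteq> 0 \<Longrightarrow> \<exists>p\<in>C. x = tmap p T"
  unfolding alt_def by (rule ccontr, erule notE, rule sum.neutral) auto

text \<open>The sum of the row numbers decides: it is the same for the two fillings, and on a column with
  distinct row numbers it is least when these form an initial segment.\<close>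

lemma column_distinct_imp_cell:
  assumes g: "g permutes {1..N}"
    and inj: "\<And>x y. x \<in> {1..N} \<Longrightarrow> y \<in> {1..N} \<Longrightarrow> col x = col y \<Longrightarrow> row (g x) = row (g y) \<Longrightarrow> x = y"
    and x: "x \<in> {1..N}"
  shows "(row (g x), col x) \<in> diagram lam"
proof -
  let ?J = "col ` {1..N}"
  let ?K = "\<lambda>j. {x. x \<in> {1..N} \<and> col x = j}"
  \<comment> \<open>The parts of \<open>lam\<close> do not increase, so each column occupies an
    initial segment of row numbers.\<close>
  have seg: "row ` ?K j = {..<card (?K j)}" for j
  proof -
    have "(row x, j) \<in> diagram lam" if "x \<in> ?K j" for x
      using that cell_in[of x] by auto
    moreover have "i \<in> row ` ?K j" if "(i, j) \<in> diagram lam" for i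
      using t_in[OF that] row_t[OF that] col_t[OF that]
      by (intro image_eqI[of _ _ "t (i, j)"]) simp_all
    ultimately have eq: "row ` ?K j = {i. (i, j) \<in> diagram lam}" by auto
    have "lam ! i \<le> lam ! i'" if "i' < i" "i < length lam" for i i'
      using that part by (auto simp: int_partition_def sorted_wrt_iff_nth_less)
    then have "(i', j) \<in> diagram lam" if "(i, j) \<in> diagram lam" "i' < i" for i i'
      using that by (fastforce simp: diagram_def)
    moreover have "finite (row ` ?K j)" by simp
    ultimately have "row ` ?K j = {..<card (row ` ?K j)}"
      unfolding eq by (intro down_closed_eq_lessThan) blast+
    moreover have "card (row ` ?K j) = card (?K j)"
      by (intro card_image) (auto simp: inj_on_def intro: cell_eqI)
    ultimately show ?thesis by simp
  qed
  have tri: "\<Sum>{..<card (?K j)} = (\<Sum>x\<in>?K j. row x)" for j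
    unfolding seg[symmetric] by (subst sum.reindex) (auto simp: inj_on_def intro: cell_eqI)
  have injK: "inj_on (\<lambda>x. row (g x)) (?K j)" for j
    using inj by (auto simp: inj_on_def)
  have le: "(\<Sum>x\<in>?K j. row x) \<le> (\<Sum>x\<in>?K j. row (g x))" for j
    using sum_inj_ge_triangle(1)[OF _ injK, of j] tri by simp
  \<comment> \<open>The permutation \<open>g\<close> only rearranges the summands, so the totals
    over all columns agree.\<close>
  have "(\<Sum>x\<in>{1..N}. row (g x)) = (\<Sum>x\<in>{1..N}. row x)"
    using sum.permute[OF g, of row] by (simp add: comp_def)
  then have "(\<Sum>j\<in>?J. \<Sum>x\<in>?K j. row x) = (\<Sum>j\<in>?J. \<Sum>x\<in>?K j. row (g x))"
    using sum.image_gen[of "{1..N}" row col] sum.image_gen[of "{1..N}" "\<lambda>x. row (g x)" col] by simp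
  \<comment> \<open>Column by column one sum is at most the other; equal totals force equality in
    each column.\<close>
  then have "(\<Sum>y\<in>?K (col x). row y) = (\<Sum>y\<in>?K (col x). row (g y))"
    by (rule sum_mono_inv[where f = "\<lambda>j. \<Sum>y\<in>?K j. row y" and I = ?J])
      (use le x in blast)+
  then have "(\<lambda>y. row (g y)) ` ?K (col x) = row ` ?K (col x)"
    using sum_inj_ge_triangle(2)[OF _ injK, of "col x"] tri seg by simp
  moreover have "row (g x) \<in> (\<lambda>y. row (g y)) ` ?K (col x)" using x by auto
  ultimately obtain y where "y \<in> ?K (col x)" "row (g x) = row y" by auto
  then show ?thesis using cell_in[of y] by auto
qed

text \<open>Each entry \<open>x\<close> is moved by \<open>q\<close> within its column of
  \<open>t\<close> to the row in which the tabloid \<open>tmap g T\<close> holds it; that cell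
  exists by \<open>column_distinct_imp_cell\<close>. Then \<open>q\<close> preserves columns, and
  its inverse carries \<open>T\<close> to \<open>tmap g T\<close>.\<close>

lemma column_distinct_imp_C:
  assumes g: "g permutes {1..N}"
    and inj: "\<And>x y. x \<in> {1..N} \<Longrightarrow> y \<in> {1..N} \<Longrightarrow> col x = col y \<Longrightarrow>
      row (inv g x) = row (inv g y) \<Longrightarrow> x = y"
  shows "\<exists>p\<in>C. tmap p T = tmap g T"
proof -
  define q where "q = (\<lambda>x. if x \<in> {1..N} then t (row (inv g x), col x) else x)"
  have cell: "(row (inv g x), col x) \<in> diagram lam" if "x \<in> {1..N}" for x
    using column_distinct_imp_cell[OF permutes_inv[OF g] inj that] by blast
  have q: "row (q x) = row (inv g x)" "col (q x) = col x" "q x \<in> {1..N}" if "x \<in> {1..N}" for x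
    using that row_t[OF cell] col_t[OF cell] t_in[OF cell] by (simp_all add: q_def)
  have "inj_on q {1..N}"
    using q inj by (metis (no_types, lifting) inj_onI)
  then have "bij_betw q {1..N} {1..N}"
    using q(3) by (intro bij_betw_imageI endo_inj_surj) auto
  then have qp: "q permutes {1..N}"
    by (intro bij_imp_permutes) (auto simp: q_def)
  then have "q \<in> C" using q(2) by (auto simp: C_def)
  then have "inv q \<in> C" using C_group by (simp add: perm_group_def)
  moreover have "tmap (inv q) T = tmap g T"
    using q(1) by (intro ext) (auto simp: tmap_T[OF g] tmap_T[OF permutes_inv[OF qp]] permutes_inv_inv[OF qp])
  ultimately show ?thesis by blast
qed

section \<open>Functions alternating under the column group\<close>

lemma transpose_C:
  assumes "x \<in> {1..N}" "y \<in> {1..N}" "col x = col y"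
  shows "transpose x y \<in> C"
  using assms by (auto simp: C_def transpose_def permutes_swap_id)

text \<open>Up to a factor the polytabloid is the only alternating function on tabloids. If a
  tabloid has two entries of one column of \<open>t\<close> in the same row, their transposition
  fixes it, so both sides vanish there. Otherwise it is \<open>tmap p T\<close> with
  \<open>p\<close> in \<open>C\<close>, where both sides are determined by their values at
  \<open>T\<close>.\<close>

lemma alternating_eq:
  fixes w :: "(nat \<Rightarrow> nat set) \<Rightarrow> int"
  assumes w: "\<And>p x. p \<in> C \<Longrightarrow> w (tmap p x) = sign p * w x"
    and supp: "\<And>x. w x \<noteq> 0 \<Longrightarrow> \<exists>g. g permutes {1..N} \<and> x = tmap g T"
  shows "w x = w T * alt x"
proof (cases "\<exists>g. g permutes {1..N} \<and> x = tmap g T")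
  case False
  then have "w x = 0" "alt x = 0" using supp alt_support C_permutes by blast+
  then show ?thesis by simp
next
  case True
  then obtain g where g: "g permutes {1..N}" and x: "x = tmap g T" by blast
  show ?thesis
  proof (cases "\<exists>y z. y \<in> {1..N} \<and> z \<in> {1..N} \<and> y \<noteq> z \<and> col y = col z \<and>
      row (inv g y) = row (inv g z)")
    case True
    then obtain y z where yz: "y \<in> {1..N}" "z \<in> {1..N}" "y \<noteq> z" "col y = col z"
      "row (inv g y) = row (inv g z)" by blast
    define u where "u = transpose y z"
    have u: "u \<in> C" using yz transpose_C u_def by simp
    have "sign u = -1" using yz by (simp add: u_def sign_swap_id)
    moreover have "tmap u x = x"
    proof
      fix i
      have "y \<in> x i \<longleftrightarrow> z \<in> x i" unfolding x tmap_T[OF g] using yz by simp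
      then show "tmap u x i = x i" by (simp add: tmap_def u_def)
    qed
    ultimately have "w x = - w x" "alt x = - alt x"
      using w[OF u, of x] alt_tmap[OF u, of x] by simp_all
    then show ?thesis by simp
  next
    case False
    then obtain p where p: "p \<in> C" "tmap p T = tmap g T"
      using column_distinct_imp_C[OF g] by blast
    then show ?thesis using w[OF p(1), of T] alt_tmap[OF p(1), of T] x alt_T by simp
  qed
qed


section \<open>Symmetrization over the first two rows outside the first column\<close>

definition R :: "(nat \<Rightarrow> nat) set" where
  "R = {r. r permutes {x \<in> {1..N}. row x \<le> 1 \<and> col x \<ge> 1} \<and> (\<forall>x. row (r x) = row x)}"

lemma R_permutes: "r \<in> R \<Longrightarrow> r permutes {1..N}"
  unfolding R_def by (auto elim: permutes_subset)

lemma R_bij: "r \<in> R \<Longrightarrow> bij r"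
  using R_permutes permutes_bij by blast

lemma R_group: "perm_group R"
  unfolding R_def
proof (rule perm_group_permutes)
  fix p assume "p permutes {x \<in> {1..N}. row x \<le> 1 \<and> col x \<ge> 1}" "\<forall>x. row (p x) = row x"
  then show "\<forall>x. row (inv p x) = row x" by (metis permutes_inverses(1))
qed auto

lemma R_T:
  assumes "r \<in> R"
  shows "tmap r T = T"
proof
  fix i
  have "row (inv r x) = row x" for x
    using assms permutes_inverses(1)[OF R_permutes[OF assms]] by (metis (mono_tags, lifting) R_def mem_Collect_eq)
  then show "tmap r T i = T i"
    by (simp add: tmap_T[OF R_permutes[OF assms]] T_eq)
qed

text \<open>Since \<open>R\<close> is closed under inverses, this is the sum of the translates of
  the polytabloid by \<open>R\<close>.\<close>

definition rsym :: "(nat \<Rightarrow> nat set) \<Rightarrow> int" where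
  "rsym x = (\<Sum>r\<in>R. alt (tmap r x))"

lemma rsym_R:
  assumes "u \<in> R"
  shows "rsym (tmap u x) = rsym x"
  unfolding rsym_def tmap_comp[symmetric] by (rule sum_perm_group_right[OF R_group assms])

lemma rsym_T: "rsym T = int (card R)"
  by (simp add: rsym_def R_T alt_T)

lemma card_R: "card R > 0"
  using R_group by (auto simp: perm_group_def card_gt_0_iff)

definition Z :: "nat set" where "Z = {x \<in> {1..N}. col x = 0}"

lemma permutes_Z_C:
  assumes "u permutes Z"
  shows "u \<in> C"
proof -
  have "col (u x) = col x" for x
  proof (cases "x \<in> Z")
    case True
    then have "u x \<in> Z" using permutes_in_image[OF assms] by simp
    then show ?thesis using True by (simp add: Z_def)
  next
    case False
    then show ?thesis using assms by (simp add: permutes_not_in)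
  qed
  moreover have "u permutes {1..N}"
    using assms by (rule permutes_subset) (auto simp: Z_def)
  ultimately show ?thesis by (simp add: C_def)
qed

text \<open>Elements of \<open>R\<close> fix the first column pointwise and \<open>u\<close> moves
  nothing else. They therefore commute, and the sign of \<open>u\<close> can be pulled out of each
  summand.\<close>

lemma rsym_Z:
  assumes u: "u permutes Z"
  shows "rsym (tmap u x) = sign u * rsym x"
proof -
  have "r \<circ> u = u \<circ> r" if r: "r \<in> R" for r
  proof
    fix y
    let ?M = "{x \<in> {1..N}. row x \<le> 1 \<and> col x \<ge> 1}"
    have rp: "r permutes ?M" using r by (simp add: R_def)
    have "Z \<inter> ?M = {}" by (auto simp: Z_def)
    then consider "y \<in> Z" "y \<notin> ?M" | "y \<notin> Z" "y \<in> ?M" | "y \<notin> Z" "y \<notin> ?M" by blast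
    then show "(r \<circ> u) y = (u \<circ> r) y"
    proof cases
      case 1
      then have "u y \<notin> ?M" using permutes_in_image[OF u, of y] \<open>Z \<inter> ?M = {}\<close> by blast
      then show ?thesis using permutes_not_in[OF rp] 1 by simp
    next
      case 2
      then have "r y \<notin> Z" using permutes_in_image[OF rp, of y] \<open>Z \<inter> ?M = {}\<close> by blast
      then show ?thesis using permutes_not_in[OF u] 2 by simp
    next
      case 3
      then show ?thesis using permutes_not_in[OF u] permutes_not_in[OF rp] by simp
    qed
  qed
  then have "rsym (tmap u x) = (\<Sum>r\<in>R. alt (tmap u (tmap r x)))"
    unfolding rsym_def by (intro sum.cong refl) (simp add: tmap_comp[symmetric])
  then show ?thesis
    by (simp add: alt_tmap permutes_Z_C u rsym_def sum_distrib_left)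
qed

text \<open>Translation by \<open>u \<circ> v\<close> permutes the summands, yet \<open>u\<close>
  contributes a factor -1 and \<open>v\<close> none. The sum equals its own negative.\<close>

lemma sum_rsym_eq_0:
  assumes K: "perm_group K" and u: "u \<circ> v \<in> K" "u permutes Z" "sign u = -1" "v \<in> R"
  shows "(\<Sum>h\<in>K. rsym (tmap h x)) = 0"
proof -
  have "(\<Sum>h\<in>K. rsym (tmap h x)) = (\<Sum>h\<in>K. rsym (tmap (u \<circ> v \<circ> h) x))"
    by (rule sum_perm_group_left[OF K u(1), symmetric])
  also have "\<dots> = - (\<Sum>h\<in>K. rsym (tmap h x))"
    by (simp add: tmap_comp rsym_Z u rsym_R sum_negf)
  finally show ?thesis by simp
qed

section \<open>Recovering the polytabloid by antisymmetrizing over the columns\<close>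

definition kap :: "(nat \<Rightarrow> nat set) \<Rightarrow> int" where
  "kap x = (\<Sum>p\<in>C. sign p * rsym (tmap p x))"

lemma kap_C:
  assumes u: "u \<in> C"
  shows "kap (tmap u x) = sign u * kap x"
proof -
  have "kap (tmap u x) = (\<Sum>p\<in>C. sign u * (sign (p \<circ> u) * rsym (tmap (p \<circ> u) x)))"
    unfolding kap_def by (intro sum.cong refl) (simp add: sign_C u tmap_comp)
  also have "\<dots> = sign u * kap x"
    unfolding kap_def sum_distrib_left
    by (rule sum_perm_group_right[OF C_group u])
  finally show ?thesis .
qed

lemma kap_support:
  assumes "kap x \<noteq> 0"
  shows "\<exists>g. g permutes {1..N} \<and> x = tmap g T"
proof -
  obtain p where p: "p \<in> C" "rsym (tmap p x) \<noteq> 0"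
    using assms unfolding kap_def by (metis (no_types, lifting) mult_zero_right sum.not_neutral_contains_not_neutral)
  then obtain r where r: "r \<in> R" "alt (tmap r (tmap p x)) \<noteq> 0"
    unfolding rsym_def by (metis (no_types, lifting) sum.not_neutral_contains_not_neutral)
  then obtain q where q: "q \<in> C" "tmap (r \<circ> p) x = tmap q T"
    using alt_support[of "tmap r (tmap p x)"] by (auto simp: tmap_comp)
  have rp: "r \<circ> p permutes {1..N}"
    using p r by (intro permutes_compose) (auto simp: C_permutes R_permutes)
  have "x = tmap (inv (r \<circ> p)) (tmap (r \<circ> p) x)"
    using tmap_inv(1)[OF permutes_bij[OF rp]] by metis
  also have "\<dots> = tmap (inv (r \<circ> p) \<circ> q) T"
    using q(2) by (simp add: tmap_comp)
  finally show ?thesis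
    using permutes_compose[OF C_permutes[OF q(1)] permutes_inv[OF rp]] by blast
qed

lemma kap_eq: "kap x = kap T * alt x"
  by (rule alternating_eq) (use kap_C kap_support in auto)

text \<open>The value \<open>kap T\<close> is the scalar product of \<open>alt\<close> and
  \<open>rsym\<close> over all tabloids. Averaging over \<open>R\<close>, under which
  \<open>rsym\<close> is invariant, turns \<open>card R\<close> times this product into the scalar
  product of \<open>rsym\<close> with itself, which is positive because \<open>rsym T\<close>
  is.\<close>

lemma kap_T_pos: "kap T > 0"
proof -
  \<comment> \<open>The orbit of \<open>T\<close> consists of all tabloids of shape
    \<open>lam\<close>.\<close>
  define X where "X = (\<lambda>g. tmap g T) ` {g. g permutes {1..N}}"
  have finX: "finite X" unfolding X_def by (simp add: finite_permutations)
  have TX: "T \<in> X" unfolding X_def by (rule image_eqI[of _ _ id]) (auto simp: permutes_id)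
  have injC: "inj_on (\<lambda>p. tmap p T) C"
  proof (rule inj_onI)
    fix p q assume pq: "p \<in> C" "q \<in> C" "tmap p T = tmap q T"
    then have "tmap (inv q \<circ> p) T = T" by (simp add: tmap_comp tmap_inv C_bij)
    moreover have "inv q \<circ> p \<in> C" using pq C_group by (simp add: perm_group_def)
    ultimately have "inv q \<circ> p = id" by (intro C_fixing_T)
    then have "q \<circ> (inv q \<circ> p) = q" by simp
    then show "p = q" using C_bij[OF pq(2)] by (simp add: fun_eq_iff bij_is_surj surj_f_inv_f)
  qed
  have "kap T = (\<Sum>p\<in>C. alt (tmap p T) * rsym (tmap p T))"
    by (simp add: kap_def alt_tmap alt_T)
  also have "\<dots> = (\<Sum>x\<in>(\<lambda>p. tmap p T) ` C. alt x * rsym x)"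
    by (simp add: sum.reindex[OF injC])
  also have "\<dots> = (\<Sum>x\<in>X. alt x * rsym x)"
  proof (rule sum.mono_neutral_left[OF finX])
    show "(\<lambda>p. tmap p T) ` C \<subseteq> X" unfolding X_def using C_permutes by auto
    show "\<forall>x\<in>X - (\<lambda>p. tmap p T) ` C. alt x * rsym x = 0" using alt_support by force
  qed
  finally have kap: "kap T = (\<Sum>x\<in>X. alt x * rsym x)" .
  have shift: "(\<Sum>x\<in>X. alt x * rsym x) = (\<Sum>x\<in>X. alt (tmap r x) * rsym x)" if r: "r \<in> R" for r
  proof -
    have X: "tmap g x \<in> X" if "x \<in> X" "g permutes {1..N}" for x g
    proof -
      obtain h where h: "h permutes {1..N}" "x = tmap h T" using \<open>x \<in> X\<close> X_def by blast
      show ?thesis unfolding X_def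
        by (rule image_eqI[of _ _ "g \<circ> h"]) (use h that permutes_compose in \<open>auto simp: tmap_comp\<close>)
    qed
    note rp = R_permutes[OF r]
    have "(\<Sum>x\<in>X. alt x * rsym x) = (\<Sum>x\<in>X. alt (tmap r x) * rsym (tmap r x))"
      by (rule sum.reindex_bij_witness[where i = "tmap r" and j = "tmap (inv r)"])
        (use X rp permutes_inv[OF rp] in \<open>auto simp: tmap_inv[OF R_bij[OF r]]\<close>)
    then show ?thesis by (simp add: rsym_R r)
  qed
  have "int (card R) * kap T = (\<Sum>r\<in>R. \<Sum>x\<in>X. alt (tmap r x) * rsym x)"
    unfolding kap by (simp add: shift[symmetric] cong: sum.cong)
  also have "\<dots> = (\<Sum>x\<in>X. rsym x * rsym x)"
    by (subst sum.swap) (simp add: rsym_def sum_distrib_right)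
  also have "\<dots> > 0"
    by (rule sum_pos2[OF finX TX]) (use card_R in \<open>auto simp: rsym_T\<close>)
  finally show ?thesis by (simp add: zero_less_mult_iff)
qed

end

section \<open>Stabilizers of set partitions\<close>

definition stab :: "nat \<Rightarrow> nat set set \<Rightarrow> (nat \<Rightarrow> nat) set" where
  "stab N P = {g. g permutes {1..N} \<and> (`) g ` P = P}"

lemma image_image_comp: "(`) (g \<circ> h) ` P = (`) g ` (`) h ` P"
  by (simp add: image_image image_comp[symmetric] del: image_comp)

lemma image_image_inv: "bij g \<Longrightarrow> (`) (inv g) ` (`) g ` P = P" "bij g \<Longrightarrow> (`) g ` (`) (inv g) ` P = P"
  by (simp_all only: image_image_comp[symmetric] bij_is_inj inv_o_cancel bij_is_surj surj_iff[THEN iffD1]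
      image_id id_apply)

lemma stab_group: "perm_group (stab N P)"
  unfolding stab_def
proof (rule perm_group_permutes)
  show "(`) (p \<circ> q) ` P = P" if "(`) p ` P = P" "(`) q ` P = P" for p q
    unfolding image_image_comp that ..
  show "(`) (inv p) ` P = P" if "p permutes {1..N}" "(`) p ` P = P" for p
    using image_image_inv(1)[OF permutes_bij[OF that(1)], of P] that(2) by simp
qed auto

lemma set_parts_image:
  assumes P: "P \<in> set_parts a b" and g: "g permutes {1..a * b}"
  shows "(`) g ` P \<in> set_parts a b"
proof -
  have inj: "inj g" using g by (rule permutes_inj)
  have part: "partition_on {1..a * b} P" using P by (simp add: set_parts_def)
  \<comment> \<open>The image rule for partitions discards empty blocks; here there are
    none.\<close>
  then have "(`) g ` P - {{}} = (`) g ` P" by (auto simp: partition_on_def)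
  then have "partition_on {1..a * b} ((`) g ` P)"
    using partition_on_inj_image[OF part inj_on_subset[OF inj subset_UNIV]] permutes_image[OF g]
    by simp
  moreover have "card ((`) g ` P) = card P"
    using inj by (intro card_image) (auto simp: inj_on_def inj_image_eq_iff)
  moreover have "card (g ` X) = card X" for X
    using inj by (intro card_image) (auto intro: inj_on_subset)
  ultimately show ?thesis using P by (auto simp: set_parts_def)
qed

text \<open>The stabilizer of the image of \<open>P\<close> under \<open>p\<close> is the conjugate
  by \<open>p\<close> of the stabilizer of \<open>P\<close>.\<close>

lemma sum_stab_conjugate:
  assumes p: "p permutes {1..N}"
  shows "(\<Sum>h\<in>stab N P. f (p \<circ> h)) = (\<Sum>h\<in>stab N ((`) p ` P). f (h \<circ> p))"
proof (rule sum.reindex_bij_witness[where i = "\<lambda>h. inv p \<circ> h \<circ> p" and j = "\<lambda>h. p \<circ> h \<circ> inv p"])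
  note b = permutes_bij[OF p]
  fix h
  show "inv p \<circ> (p \<circ> h \<circ> inv p) \<circ> p = h" "p \<circ> (inv p \<circ> h \<circ> p) \<circ> inv p = h"
      "f (p \<circ> h \<circ> inv p \<circ> p) = f (p \<circ> h)"
    by (simp_all add: fun_eq_iff comp_def permutes_inverses[OF p])
  {
    assume "h \<in> stab N P"
    then show "p \<circ> h \<circ> inv p \<in> stab N ((`) p ` P)"
      using p permutes_inv[OF p]
      by (auto simp only: stab_def mem_Collect_eq image_image_comp image_image_inv[OF b]
          intro!: permutes_compose)
  }
  assume "h \<in> stab N ((`) p ` P)"
  then show "inv p \<circ> h \<circ> p \<in> stab N P"
    using p permutes_inv[OF p]
    by (auto simp only: stab_def mem_Collect_eq image_image_comp image_image_inv[OF b]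
        intro!: permutes_compose)
qed

context young_tableau
begin

text \<open>By \<open>kap_eq\<close> and \<open>kap_T_pos\<close>, \<open>alt\<close> may be
  replaced by \<open>kap\<close>. Moving a column permutation \<open>p\<close> past the stabilizer
  replaces \<open>P\<close> by its image under \<open>p\<close>, which is why \<open>vanish\<close>
  covers every set partition.\<close>

lemma sum_alt_eq_0:
  assumes "N = a * b" and P: "P \<in> set_parts a b"
    and vanish: "\<And>P x. P \<in> set_parts a b \<Longrightarrow> (\<Sum>h\<in>stab N P. rsym (tmap h x)) = 0"
  shows "(\<Sum>h\<in>stab N P. alt (tmap h x)) = 0"
proof -
  have "kap T * (\<Sum>h\<in>stab N P. alt (tmap h x)) = (\<Sum>h\<in>stab N P. kap (tmap h x))"
    unfolding sum_distrib_left by (intro sum.cong refl kap_eq[symmetric])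
  also have "\<dots> = (\<Sum>p\<in>C. sign p * (\<Sum>h\<in>stab N P. rsym (tmap (p \<circ> h) x)))"
    unfolding kap_def by (subst sum.swap) (simp add: sum_distrib_left tmap_comp)
  also have "\<dots> = 0"
  proof (intro sum.neutral ballI)
    fix p assume "p \<in> C"
    then have p: "p permutes {1..N}" by (rule C_permutes)
    have "(\<Sum>h\<in>stab N P. rsym (tmap (p \<circ> h) x)) = (\<Sum>h\<in>stab N ((`) p ` P). rsym (tmap h (tmap p x)))"
      using sum_stab_conjugate[OF p, of "\<lambda>h. rsym (tmap h x)" P] by (simp add: tmap_comp)
    also have "\<dots> = 0"
      using vanish set_parts_image[OF P] p assms(1) by simp
    finally show "sign p * (\<Sum>h\<in>stab N P. rsym (tmap (p \<circ> h) x)) = 0" by simp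
  qed
  finally show ?thesis using kap_T_pos by simp
qed


section \<open>Counting cells and finding an odd permutation in the stabilizer\<close>

lemma card_Z: "card Z = length lam"
proof -
  have "{c \<in> diagram lam. snd c = 0} = (\<lambda>i. (i, 0)) ` {..<length lam}"
    using part by (auto simp: diagram_def int_partition_def)
  then show ?thesis
    using card_cells[of "\<lambda>r c. c = 0"] by (simp add: Z_def card_image inj_on_def)
qed

lemma card_row1:
  assumes "length lam \<ge> 2"
  shows "card {x \<in> {1..N}. row x = 1 \<and> col x \<ge> 1} = lam ! 1 - 1"
proof -
  have "{c \<in> diagram lam. fst c = 1 \<and> snd c \<ge> 1} = (\<lambda>j. (1, j)) ` {1..<lam ! 1}"
    using assms by (auto simp: diagram_def)
  then show ?thesis
    using card_cells[of "\<lambda>r c. r = 1 \<and> c \<ge> 1"] by (simp add: card_image inj_on_def)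
qed

lemma card_lower_rows:
  "card {x \<in> {1..N}. row x \<ge> 2 \<and> col x \<ge> 1} = (\<Sum>i = 2..<length lam. lam ! i - 1)"
proof -
  have "{c \<in> diagram lam. fst c \<ge> 2 \<and> snd c \<ge> 1} = (SIGMA i:{2..<length lam}. {1..<lam ! i})"
    by (auto simp: diagram_def)
  then show ?thesis
    using card_cells[of "\<lambda>r c. r \<ge> 2 \<and> c \<ge> 1"] by (simp add: card_SigmaI)
qed

text \<open>If no block contains two entries of the first column, then at least \<open>length lam - n\<close> of the
  blocks meeting it avoid the lower rows. Too few entries of row \<open>1\<close> are available to give these
  blocks distinct numbers of them, and two blocks with equal numbers can be interchanged.\<close>

lemma odd_stabilizer_element:
  assumes N: "N = a * b" and P: "P \<in> set_parts a b" and len: "length lam \<ge> 2"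
    and n: "n = (\<Sum>i = 2..<length lam. lam ! i - 1)" "n < length lam"
    and bound: "lam ! 1 - 1 < \<Sum>{..<length lam - n}"
  shows "\<exists>u v. u permutes Z \<and> sign u = -1 \<and> v \<in> R \<and> u \<circ> v \<in> stab N P"
proof -
  define A where "A = {x \<in> {1..N}. row x = 1 \<and> col x \<ge> 1}"
  define H where "H = {x \<in> {1..N}. row x = 0 \<and> col x \<ge> 1}"
  define L where "L = {x \<in> {1..N}. row x \<ge> 2 \<and> col x \<ge> 1}"
  have cover: "\<Union>P = {1..N}" and disj: "\<And>X Y. X \<in> P \<Longrightarrow> Y \<in> P \<Longrightarrow> X \<noteq> Y \<Longrightarrow> X \<inter> Y = {}"
    and cardP: "\<And>X. X \<in> P \<Longrightarrow> card X = a"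
    using P by (auto simp: set_parts_def partition_on_def disjoint_def N)
  have finP: "finite X" if "X \<in> P" for X
    using cover that by (intro finite_subset[of X "{1..N}"]) auto
  define blk where "blk x = (THE X. X \<in> P \<and> x \<in> X)" for x
  have inN: "z \<in> {1..N}" if "X \<in> P" "z \<in> X" for X z
    unfolding cover[symmetric] using that by blast
  have blk_eq: "blk x = X" if "X \<in> P" "x \<in> X" for x X
    unfolding blk_def using disj that by (intro the_equality) auto
  have blk: "blk x \<in> P" "x \<in> blk x" if "x \<in> {1..N}" for x
  proof -
    have "x \<in> \<Union>P" using that by (simp only: cover)
    then obtain X where X: "X \<in> P" "x \<in> X" by blast
    show "blk x \<in> P" "x \<in> blk x" unfolding blk_eq[OF X] by (fact X)+
  qed
  have Z_sub: "Z \<subseteq> {1..N}" by (auto simp: Z_def)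
  have finZ: "finite Z" by (rule finite_subset[OF Z_sub]) simp
  \<comment> \<open>Exchanging two blocks and fixing all other points preserves \<open>P\<close>.
    The case \<open>X = Y\<close> is included and serves for a transposition inside one
    block.\<close>
  have stabI: "u \<in> stab N P" if u: "u permutes {1..N}" "X \<in> P" "Y \<in> P" "u ` X = Y" "u ` Y = X"
    "\<And>z. z \<notin> X \<union> Y \<Longrightarrow> u z = z" for u X Y
  proof -
    have other: "u ` W = W" if "W \<in> P" "W \<noteq> X" "W \<noteq> Y" for W
    proof -
      have "u z = z" if "z \<in> W" for z
        using disj[of W X] disj[of W Y] \<open>W \<in> P\<close> \<open>W \<noteq> X\<close> \<open>W \<noteq> Y\<close> u(2,3) u(6)[of z] that by blast
      then show ?thesis by force
    qed
    have "u ` W \<in> P" "W \<in> (`) u ` P" if "W \<in> P" for W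
      using u(2-5) other[OF that] that by (metis image_eqI)+
    then have "(`) u ` P = P" by blast
    then show ?thesis using u(1) by (simp add: stab_def)
  qed
  show ?thesis
  proof (cases "inj_on blk Z")
    case False
    then obtain x y where xy: "x \<in> Z" "y \<in> Z" "x \<noteq> y" "blk x = blk y" by (auto simp: inj_on_def)
    define u where "u = transpose x y"
    have uZ: "u permutes Z" using xy by (simp add: u_def permutes_swap_id)
    have "x \<in> {1..N}" "y \<in> {1..N}" using xy Z_sub by blast+
    then have in_blk: "blk x \<in> P" "x \<in> blk x" "y \<in> blk x"
      using blk(1)[of x] blk(2)[of x] blk(2)[of y] unfolding xy(4) by blast+
    then have "u ` blk x = blk x" by (simp add: u_def)
    moreover have "u z = z" if "z \<notin> blk x \<union> blk x" for z
      using in_blk that by (auto simp: u_def transpose_def)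
    ultimately have "u \<in> stab N P"
      using in_blk(1) C_permutes[OF permutes_Z_C[OF uZ]] by (intro stabI[of u "blk x" "blk x"])
    moreover have "sign u = -1" using xy by (simp add: u_def sign_swap_id)
    moreover have "id \<in> R" using R_group by (simp add: perm_group_def)
    ultimately show ?thesis using uZ by (intro exI[of _ u] exI[of _ id]) simp
  next
    case True
    define D where "D = {x \<in> Z. blk x \<inter> L = {}}"
    define cnt where "cnt x = card (blk x \<inter> A)" for x
    have finD: "finite D" using finZ by (simp add: D_def)
    \<comment> \<open>Each element of \<open>Z - D\<close> has an entry of \<open>L\<close> in its
      block. Distinct elements of \<open>Z\<close> lie in distinct blocks, so choosing such an entry
      is injective.\<close>
    have "card (Z - D) \<le> card L"
    proof (rule card_inj_on_le)
      show "finite L" by (simp add: L_def)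
      define pick where "pick x = (SOME z. z \<in> blk x \<inter> L)" for x
      have pick: "pick x \<in> blk x \<inter> L" if "x \<in> Z - D" for x
      proof -
        have "\<exists>z. z \<in> blk x \<inter> L" using that unfolding D_def by blast
        then show ?thesis unfolding pick_def by (rule someI_ex)
      qed
      then show "pick ` (Z - D) \<subseteq> L" by blast
      show "inj_on pick (Z - D)"
      proof (rule inj_onI)
        fix x y assume xy: "x \<in> Z - D" "y \<in> Z - D" "pick x = pick y"
        have "blk (pick w) = blk w" if "w \<in> Z - D" for w
          using pick[OF that] blk(1)[of w] Z_sub that by (intro blk_eq) blast+
        then have "blk x = blk y" using xy by metis
        then show "x = y" using inj_onD[OF True] xy by blast
      qed
    qed
    moreover have "card Z = card D + card (Z - D)"
      using card_Int_Diff[OF finZ, of D] Int_absorb1[of D Z] D_def by auto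
    ultimately have cardD: "length lam - n \<le> card D"
      using card_Z card_lower_rows n L_def by simp
    \<comment> \<open>Distinct counts would add up to at least 0 + 1 + ... + (\<open>card D\<close>
      - 1), more than the entries available in \<open>A\<close>.\<close>
    have "\<not> inj_on cnt D"
    proof
      assume inj: "inj_on cnt D"
      have "\<Sum>{..<length lam - n} \<le> \<Sum>{..<card D}"
        using cardD by (intro sum_mono2) auto
      also have "\<dots> \<le> (\<Sum>x\<in>D. cnt x)"
        by (rule sum_inj_ge_triangle(1)[OF finD inj])
      also have "\<dots> = card (\<Union>x\<in>D. blk x \<inter> A)"
        unfolding cnt_def
      proof (rule card_UN_disjoint[symmetric, OF finD])
        show "\<forall>x\<in>D. finite (blk x \<inter> A)" by (simp add: A_def)
        show "\<forall>x\<in>D. \<forall>y\<in>D. x \<noteq> y \<longrightarrow> (blk x \<inter> A) \<inter> (blk y \<inter> A) = {}"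
        proof (intro ballI impI)
          fix x y assume xy: "x \<in> D" "y \<in> D" "x \<noteq> y"
          then have "x \<in> Z" "y \<in> Z" by (auto simp: D_def)
          then have "blk x \<noteq> blk y" "blk x \<in> P" "blk y \<in> P"
            using inj_onD[OF True] xy(3) blk(1)[of x] blk(1)[of y] Z_sub by blast+
          then show "(blk x \<inter> A) \<inter> (blk y \<inter> A) = {}" using disj by blast
        qed
      qed
      also have "\<dots> \<le> card A" by (intro card_mono) (auto simp: A_def)
      also have "\<dots> = lam ! 1 - 1" unfolding A_def by (rule card_row1[OF len])
      finally show False using bound by simp
    qed
    then obtain x y where xy: "x \<in> D" "y \<in> D" "x \<noteq> y" "cnt x = cnt y" by (auto simp: inj_on_def)
    define X where "X = blk x"
    define Y where "Y = blk y"
    have xyZ: "x \<in> Z" "y \<in> Z" using xy by (auto simp: D_def)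
    have XY: "X \<in> P" "Y \<in> P" "x \<in> X" "y \<in> Y"
      unfolding X_def Y_def using blk[of x] blk[of y] xyZ Z_sub by blast+
    have "X \<noteq> Y" unfolding X_def Y_def using inj_onD[OF True] xy(3) xyZ by blast
    then have XYdisj: "X \<inter> Y = {}" using disj XY by blast
    \<comment> \<open>No other entry of the first column lies in the block of \<open>w\<close>, and
      by the choice of \<open>D\<close> no entry of \<open>L\<close> does.\<close>
    have split: "blk w = insert w (blk w \<inter> A \<union> blk w \<inter> H)" if w: "w \<in> D" for w
    proof -
      have wZ: "w \<in> Z" and wL: "blk w \<inter> L = {}" using w by (auto simp: D_def)
      have w': "blk w \<in> P" "w \<in> blk w" using blk[of w] wZ Z_sub by blast+
      have "z = w \<or> z \<in> A \<or> z \<in> H" if z: "z \<in> blk w" for z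
      proof (cases "col z = 0")
        case True': True
        have "z \<in> {1..N}" using inN w'(1) z .
        then have "z \<in> Z" using True' by (simp add: Z_def)
        moreover have "blk z = blk w" using w'(1) z by (rule blk_eq)
        ultimately show ?thesis using inj_onD[OF True] wZ by blast
      next
        case False
        have "z \<in> {1..N}" using inN w'(1) z .
        moreover have "z \<notin> L" using wL z by blast
        ultimately show ?thesis using False by (auto simp: A_def H_def L_def)
      qed
      then show ?thesis using w' by blast
    qed
    have disj3: "w \<notin> A" "w \<notin> H" if "w \<in> Z" for w using that by (auto simp: Z_def A_def H_def)
    have AH: "A \<inter> H = {}" by (auto simp: A_def H_def)
    have card_split: "a = 1 + cnt w + card (blk w \<inter> H)" if w: "w \<in> D" for w
    proof -
      have wZ: "w \<in> Z" using w by (auto simp: D_def)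
      have fin: "finite (blk w \<inter> A)" "finite (blk w \<inter> H)" by (simp_all add: A_def H_def)
      have "a = card (blk w)" using cardP[of "blk w"] blk(1)[of w] wZ Z_sub by blast
      also have "\<dots> = card (insert w (blk w \<inter> A \<union> blk w \<inter> H))" using arg_cong[OF split[OF w]] .
      also have "\<dots> = 1 + card (blk w \<inter> A \<union> blk w \<inter> H)"
        using disj3[OF wZ] fin by (subst card_insert_disjoint) auto
      also have "card (blk w \<inter> A \<union> blk w \<inter> H) = cnt w + card (blk w \<inter> H)"
        using fin AH unfolding cnt_def by (intro card_Un_disjoint) auto
      finally show ?thesis by simp
    qed
    \<comment> \<open>Both blocks have size \<open>a\<close>, one entry in the first column and
      equally many in \<open>A\<close>, so the remaining parts in \<open>H\<close> also
      match.\<close>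
    have "card (X \<inter> H) = card (Y \<inter> H)"
      using card_split[OF xy(1)] card_split[OF xy(2)] xy(4) by (simp add: X_def Y_def)
    moreover have fin: "finite (S \<inter> A)" "finite (S \<inter> H)" for S by (simp_all add: A_def H_def)
    moreover have "(X \<inter> H) \<inter> (Y \<inter> H) = {}" using XYdisj by blast
    ultimately obtain v where
      v: "v permutes (X \<inter> H \<union> Y \<inter> H)" "v ` (X \<inter> H) = Y \<inter> H" "v ` (Y \<inter> H) = X \<inter> H"
      using ex_swap_permutes by metis
    have "card (X \<inter> A) = card (Y \<inter> A)" using xy(4) by (simp add: cnt_def X_def Y_def)
    moreover have "(X \<inter> A) \<inter> (Y \<inter> A) = {}" using XYdisj by blast
    ultimately obtain w where
      w: "w permutes (X \<inter> A \<union> Y \<inter> A)" "w ` (X \<inter> A) = Y \<inter> A" "w ` (Y \<inter> A) = X \<inter> A"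
      using ex_swap_permutes fin(1) by metis
    define u where "u = transpose x y"
    have uZ: "u permutes Z" using xyZ by (simp add: u_def permutes_swap_id)
    have row_inv: "row (q z) = row z" if "q permutes S" "\<And>s. s \<in> S \<Longrightarrow> row s = r" for q S r z
      using that permutes_in_image[OF that(1), of z] permutes_not_in[OF that(1), of z]
      by (cases "z \<in> S") auto
    have vR: "v \<in> R"
      using v(1) row_inv[OF v(1), of 0] unfolding R_def
      by (auto simp: H_def intro: permutes_subset)
    have wR: "w \<in> R"
      using w(1) row_inv[OF w(1), of 1] unfolding R_def
      by (auto simp: A_def intro: permutes_subset)
    have wvR: "w \<circ> v \<in> R" using vR wR R_group by (simp add: perm_group_def)
    \<comment> \<open>The three factors exchange the parts of \<open>X\<close> and \<open>Y\<close>
      in the first column, in \<open>A\<close> and in \<open>H\<close>. Only \<open>u\<close>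
      affects the sign of \<open>rsym\<close>, whatever the signs of \<open>v\<close> and
      \<open>w\<close>.\<close>
    define g where "g = u \<circ> (w \<circ> v)"
    have g: "g permutes {1..N}"
      unfolding g_def using R_permutes[OF wvR] C_permutes[OF permutes_Z_C[OF uZ]]
      by (rule permutes_compose)
    have vfix: "v z = z" if "z \<notin> H" for z using that permutes_not_in[OF v(1)] by blast
    have wfix: "w z = z" if "z \<notin> A" for z using that permutes_not_in[OF w(1)] by blast
    have ufix: "u z = z" if "z \<notin> Z" for z using that permutes_not_in[OF uZ] by blast
    have AZ: "z \<notin> Z" if "z \<in> A \<or> z \<in> H" for z using that disj3 by blast
    have gA: "g z = w z" if "z \<in> A" "w z \<in> A" for z
    proof -
      have "z \<notin> H" "w z \<notin> Z" using that AH AZ by blast+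
      then show ?thesis by (simp add: g_def vfix ufix)
    qed
    have gH: "g z = v z" if "z \<in> H" "v z \<in> H" for z
    proof -
      have "v z \<notin> A" "v z \<notin> Z" using that AH AZ by blast+
      then show ?thesis by (simp add: g_def wfix ufix)
    qed
    have gxy: "g x = y" "g y = x"
      using vfix wfix disj3 xyZ by (auto simp: g_def u_def)
    have gX: "g ` X \<subseteq> Y"
    proof
      fix z assume "z \<in> g ` X"
      then obtain s where s: "s \<in> X" "z = g s" by blast
      then consider "s = x" | "s \<in> X \<inter> A" | "s \<in> X \<inter> H" using split[OF xy(1)] X_def by blast
      then show "z \<in> Y"
      proof cases
        case 2
        then have "w s \<in> Y \<inter> A" using w by blast
        then show ?thesis using gA 2 s by auto
      next
        case 3
        then have "v s \<in> Y \<inter> H" using v by blast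
        then show ?thesis using gH 3 s by auto
      qed (use gxy s XY in simp)
    qed
    have gY: "g ` Y \<subseteq> X"
    proof
      fix z assume "z \<in> g ` Y"
      then obtain s where s: "s \<in> Y" "z = g s" by blast
      then consider "s = y" | "s \<in> Y \<inter> A" | "s \<in> Y \<inter> H" using split[OF xy(2)] Y_def by blast
      then show "z \<in> X"
      proof cases
        case 2
        then have "w s \<in> X \<inter> A" using w by blast
        then show ?thesis using gA 2 s by auto
      next
        case 3
        then have "v s \<in> X \<inter> H" using v by blast
        then show ?thesis using gH 3 s by auto
      qed (use gxy s XY in simp)
    qed
    have cg: "card (g ` S) = card S" for S
      by (intro card_image inj_on_subset[OF permutes_inj[OF g]]) auto
    have "g ` X = Y" "g ` Y = X"
      using card_subset_eq[OF finP gX] card_subset_eq[OF finP gY] by (simp_all add: cg cardP XY)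
    moreover have "g z = z" if "z \<notin> X \<union> Y" for z
    proof -
      have "v z = z" "w z = z" using that permutes_not_in[OF v(1)] permutes_not_in[OF w(1)] by blast+
      moreover have "z \<noteq> x" "z \<noteq> y" using that XY by auto
      ultimately show ?thesis by (simp add: g_def u_def)
    qed
    ultimately have "g \<in> stab N P" using g XY by (intro stabI[of g X Y]) auto
    moreover have "sign u = -1" using xy by (simp add: u_def sign_swap_id)
    ultimately show ?thesis using uZ wvR unfolding g_def by blast
  qed
qed

lemma sum_stab_polytabloid:
  assumes N: "N = a * b" and P: "P \<in> set_parts a b" and len: "length lam \<ge> 2"
    and n: "n = (\<Sum>i = 2..<length lam. lam ! i - 1)" "n < length lam"
    and bound: "lam ! 1 - 1 < \<Sum>{..<length lam - n}"
  shows "(\<Sum>h\<in>stab N P. polytabloid lam t (tmap h x)) = 0"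
proof -
  have "(\<Sum>h\<in>stab N P. alt (tmap h x)) = 0"
  proof (rule sum_alt_eq_0[OF N P])
    fix Q x assume "Q \<in> set_parts a b"
    then obtain u v where "u permutes Z" "sign u = -1" "v \<in> R" "u \<circ> v \<in> stab N Q"
      using odd_stabilizer_element[OF N _ len n bound] by blast
    then show "(\<Sum>h\<in>stab N Q. rsym (tmap h x)) = 0"
      using sum_rsym_eq_0[OF stab_group] by blast
  qed
  then show ?thesis by (simp add: polytabloid_eq flip: of_int_sum)
qed

end

section \<open>Traces\<close>

lemma finite_set_parts: "finite (set_parts a b)"
proof (rule finite_subset)
  show "set_parts a b \<subseteq> Pow (Pow {1..a * b})"
    by (auto simp: set_parts_def partition_on_def)
qed simp

lemma point_vec_eq_iff: "point_vec x = point_vec y \<longleftrightarrow> x = y"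
  by (auto simp: point_vec_def fun_eq_iff split: if_splits)

lemma independent_point_vec:
  assumes "finite X"
  shows "cfun.independent (point_vec ` X)"
proof (rule cfun.independent_if_scalars_zero)
  show "finite (point_vec ` X)" using assms by simp
  fix f v assume f: "(\<Sum>v\<in>point_vec ` X. (\<lambda>y. f v * v y)) = 0" and v: "v \<in> point_vec ` X"
  obtain x where x: "x \<in> X" "v = point_vec x" using v by blast
  have "0 = (\<Sum>y\<in>X. f (point_vec y) * point_vec y x)"
    using fun_cong[OF f, of x] by (simp add: sum_fun_apply sum.reindex inj_on_def point_vec_eq_iff)
  also have "\<dots> = (\<Sum>y\<in>X. if y = x then f (point_vec y) else 0)"
    by (intro sum.cong) (auto simp: point_vec_def)
  also have "\<dots> = f v" using x assms by simp
  finally show "f v = 0" by simp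
qed

text \<open>In the basis of point vectors the action is a permutation matrix, whose diagonal marks
  the fixed points.\<close>

lemma foulkes_char_eq:
  assumes g: "g permutes {1..a * b}"
  shows "foulkes_char a b g = of_nat (card {P \<in> set_parts a b. (`) g ` P = P})"
proof -
  let ?X = "set_parts a b"
  let ?B = "point_vec ` ?X"
  define U where "U = lin_action (\<lambda>g P. (`) g ` P) g"
  note b = permutes_bij[OF g]
  have U: "U (point_vec P) = point_vec ((`) g ` P)" for P
  proof
    fix Q
    have "(`) (inv g) ` Q = P \<longleftrightarrow> Q = (`) g ` P"
      using image_image_inv[OF b] by metis
    then show "U (point_vec P) Q = point_vec ((`) g ` P) Q"
      unfolding U_def lin_action_def point_vec_def by simp
  qed
  have indep: "cfun.independent ?B"
    using finite_set_parts by (rule independent_point_vec)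
  have "U f \<in> cfun.span ?B" if "f \<in> cfun.span ?B" for f
    using that
  proof (induction rule: cfun.span_induct_alt)
    case base
    have "U 0 = 0" by (simp add: U_def lin_action_def fun_eq_iff)
    then show ?case by (simp only: cfun.span_zero)
  next
    case (step c x y)
    have "U ((\<lambda>z. c * x z) + y) = (\<lambda>z. c * U x z) + U y"
      by (simp add: U_def lin_action_def fun_eq_iff)
    moreover have "U x \<in> cfun.span ?B"
      using step(1) U set_parts_image[OF _ g] by (auto intro: cfun.span_base)
    ultimately show ?case
      using step(2) by (simp only: cfun.span_add cfun.span_scale)
  qed
  then have "foulkes_char a b g = (\<Sum>v\<in>?B. cfun.representation ?B (U v) v)"
    unfolding foulkes_char_def foulkes_module_def perm_module_def U_def[symmetric]
    by (intro lin_trace_eq indep) (auto simp: finite_set_parts U_def lin_action_def fun_eq_iff)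
  also have "\<dots> = (\<Sum>P\<in>?X. cfun.representation ?B (point_vec ((`) g ` P)) (point_vec P))"
    by (simp add: sum.reindex inj_on_def point_vec_eq_iff U)
  also have "\<dots> = (\<Sum>P\<in>?X. if (`) g ` P = P then 1 else 0)"
    using set_parts_image[OF _ g]
    by (intro sum.cong refl) (simp add: cfun.representation_basis[OF indep] point_vec_eq_iff eq_commute)
  finally show ?thesis
    using finite_set_parts by (simp add: sum.If_cases Int_def)
qed

text \<open>Conjugation by \<open>g\<close> carries the column stabilizer of \<open>t\<close> to
  that of \<open>g \<circ> t\<close> and preserves signs. Hence the spanning set of the Specht
  module is stable under the action.\<close>

lemma polytabloid_tmap_inv:
  assumes g: "g permutes {1..sum_list lam}"
  shows "polytabloid lam t (tmap (inv g) x) = polytabloid lam (g \<circ> t) x"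
proof -
  let ?N = "{1..sum_list lam}"
  note b = permutes_bij[OF g] and gi = permutes_inv[OF g]
  define c where "c j = t ` {(i, j') \<in> diagram lam. j' = j}" for j
  have C: "column_stabilizer lam t = {p. p permutes ?N \<and> (\<forall>j. p ` c j = c j)}"
    "column_stabilizer lam (g \<circ> t) = {p. p permutes ?N \<and> (\<forall>j. p ` g ` c j = g ` c j)}"
    by (simp_all add: column_stabilizer_def c_def Let_def image_comp)
  have cancel: "inv g ` g ` S = S" "g ` inv g ` S = S" for S
    using permutes_inverses[OF g] by (simp_all add: image_image)
  have shift: "tmap (inv g) x = y \<longleftrightarrow> x = tmap g y" for y
    by (auto simp: tmap_inv[OF b])
  have "polytabloid lam t (tmap (inv g) x) =
      (\<Sum>p\<in>column_stabilizer lam t. of_int (sign p) * (if x = tmap g (tmap p (tabloid lam t)) then 1 else 0))"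
    by (simp add: polytabloid_apply shift)
  also have "\<dots> = (\<Sum>q\<in>column_stabilizer lam (g \<circ> t).
      of_int (sign q) * (if x = tmap q (tabloid lam (g \<circ> t)) then 1 else 0))"
  proof (rule sum.reindex_bij_witness[where i = "\<lambda>q. inv g \<circ> q \<circ> g" and j = "\<lambda>p. g \<circ> p \<circ> inv g"])
    fix p assume p: "p \<in> column_stabilizer lam t"
    show "inv g \<circ> (g \<circ> p \<circ> inv g) \<circ> g = p"
      by (simp add: fun_eq_iff permutes_inverses[OF g])
    show "g \<circ> p \<circ> inv g \<in> column_stabilizer lam (g \<circ> t)"
      using p g gi unfolding C
      by (auto simp only: mem_Collect_eq image_comp[symmetric] cancel intro!: permutes_compose)
    have "sign (g \<circ> p \<circ> inv g) = sign g * sign p * sign (inv g)"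
      using p g gi unfolding C by (simp add: sign_compose_permutes[of ?N] permutes_compose)
    also have "\<dots> = sign p"
      using permutes_imp_permutation[OF _ g] by (simp add: sign_inverse mult.commute sign_idempotent)
    finally have "sign (g \<circ> p \<circ> inv g) = sign p" .
    moreover have "tmap (g \<circ> p \<circ> inv g) (tabloid lam (g \<circ> t)) = tmap g (tmap p (tabloid lam t))"
      by (simp add: tabloid_comp tmap_comp tmap_inv[OF b])
    ultimately show "of_int (sign (g \<circ> p \<circ> inv g)) *
        (if x = tmap (g \<circ> p \<circ> inv g) (tabloid lam (g \<circ> t)) then 1 else 0) =
        (of_int (sign p) * (if x = tmap g (tmap p (tabloid lam t)) then 1 else 0) :: complex)"
      by simp
  next
    fix q assume q: "q \<in> column_stabilizer lam (g \<circ> t)"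
    show "g \<circ> (inv g \<circ> q \<circ> g) \<circ> inv g = q"
      by (simp add: fun_eq_iff permutes_inverses[OF g])
    show "inv g \<circ> q \<circ> g \<in> column_stabilizer lam t"
      using q g gi unfolding C
      by (auto simp only: mem_Collect_eq image_comp[symmetric] cancel intro!: permutes_compose)
  qed
  finally show ?thesis unfolding polytabloid_apply .
qed

text \<open>A tableau is a function on all pairs, with arbitrary values off the diagram. The
  polytabloid depends only on the restriction to the diagram, and there are finitely many
  restrictions.\<close>

lemma finite_polytabloids: "finite {polytabloid lam t |t. tableau lam t}"
proof (rule finite_subset)
  let ?D = "diagram lam"
  let ?F = "?D \<rightarrow>\<^sub>E {1..sum_list lam}"
  show "finite (polytabloid lam ` ?F)"
    by (simp add: finite_PiE finite_diagram)
  have im: "restrict t ?D ` {c \<in> ?D. Q c} = t ` {c \<in> ?D. Q c}" for t :: "nat \<times> nat \<Rightarrow> nat" and Q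
    by (intro image_cong) auto
  have "polytabloid lam (restrict t ?D) = polytabloid lam t" for t
  proof -
    have "tabloid lam (restrict t ?D) = tabloid lam t"
      unfolding tabloid_def using im[of t "\<lambda>(i', j). i' = _"] by (simp add: case_prod_beta)
    moreover have "column_stabilizer lam (restrict t ?D) = column_stabilizer lam t"
      unfolding column_stabilizer_def using im[of t "\<lambda>(i', j). j = _"] by (simp add: case_prod_beta)
    ultimately show ?thesis by (intro ext) (simp only: polytabloid_apply)
  qed
  moreover have "restrict t ?D \<in> ?F" if "tableau lam t" for t
    using that by (auto simp: tableau_def bij_betw_def)
  ultimately show "{polytabloid lam t |t. tableau lam t} \<subseteq> polytabloid lam ` ?F"
    by (auto, metis image_eqI)
qed

text \<open>A sum of traces is the trace of the sum of the operators. That sum kills every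
  polytabloid, hence the whole Specht module.\<close>

lemma sum_specht_char_eq_0:
  assumes K: "perm_group K" "\<And>g. g \<in> K \<Longrightarrow> g permutes {1..sum_list lam}"
    and vanish: "\<And>t x. tableau lam t \<Longrightarrow> (\<Sum>h\<in>K. polytabloid lam t (tmap h x)) = 0"
  shows "(\<Sum>g\<in>K. specht_char lam g) = 0"
proof -
  let ?G = "{polytabloid lam t |t. tableau lam t}"
  define S where "S = specht_module lam"
  define U where "U g f = lin_action (\<lambda>g x i. g ` x i) g f" for g and f :: "(nat \<Rightarrow> nat set) \<Rightarrow> complex"
  have U: "U g f x = f (tmap (inv g) x)" for g f x
    by (simp add: U_def lin_action_def tmap_def)
  have spanS: "S = cfun.span ?G" by (simp add: S_def specht_module_def)
  \<comment> \<open>One finite basis is fixed so that the traces of all group elements can be added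
    entrywise.\<close>
  obtain B where B: "B \<subseteq> S" "cfun.independent B" "S \<subseteq> cfun.span B"
    using cfun.maximal_independent_subset[of S] by blast
  have BS: "cfun.span B = S"
    using B cfun.span_minimal[of B S] cfun.subspace_span[of ?G] unfolding spanS by blast
  have finB: "finite B"
    using cfun.independent_span_bound[OF finite_polytabloids B(2)] B(1) unfolding spanS by blast
  have US: "U g f \<in> S" if g: "g \<in> K" and f: "f \<in> S" for g f
    using f unfolding spanS
  proof (induction rule: cfun.span_induct_alt)
    case base
    have "U g 0 = 0" by (simp add: U fun_eq_iff)
    then show ?case by (simp only: cfun.span_zero)
  next
    case (step c x y)
    have "U g ((\<lambda>z. c * x z) + y) = (\<lambda>z. c * U g x z) + U g y"
      by (simp add: U fun_eq_iff)
    moreover have "U g x \<in> cfun.span ?G"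
    proof -
      obtain t where t: "x = polytabloid lam t" "tableau lam t" using step(1) by blast
      have "U g x = polytabloid lam (g \<circ> t)"
        using polytabloid_tmap_inv[OF K(2)[OF g]] t by (simp add: U fun_eq_iff)
      moreover have "tableau lam (g \<circ> t)"
        using t permutes_imp_bij[OF K(2)[OF g]] unfolding tableau_def by (auto intro: bij_betw_trans)
      ultimately show ?thesis by (auto intro: cfun.span_base)
    qed
    ultimately show ?case
      using step(2) by (simp only: cfun.span_add cfun.span_scale)
  qed
  have char: "specht_char lam g = (\<Sum>v\<in>B. cfun.representation B (U g v) v)" if "g \<in> K" for g
    using US[OF that] unfolding specht_char_def S_def[symmetric] U_def[abs_def, symmetric]
    by (intro lin_trace_eq finB B BS) (auto simp: U fun_eq_iff)
  have zero: "(\<Sum>h\<in>K. f (tmap h x)) = 0" if "f \<in> S" for f x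
    using that unfolding spanS
  proof (induction arbitrary: x rule: cfun.span_induct_alt)
    case (step c e y)
    then show ?case using vanish by (auto simp: sum.distrib sum_distrib_left[symmetric])
  qed simp
  have "(\<Sum>g\<in>K. specht_char lam g) = (\<Sum>v\<in>B. \<Sum>g\<in>K. cfun.representation B (U g v) v)"
    by (subst sum.swap) (simp add: char)
  also have "\<dots> = (\<Sum>v\<in>B. cfun.representation B (\<Sum>g\<in>K. U g v) v)"
  proof (intro sum.cong refl)
    fix v assume "v \<in> B"
    then have "U g v \<in> cfun.span B" if "g \<in> K" for g
      using US[OF that] B(1) unfolding BS by blast
    then show "(\<Sum>g\<in>K. cfun.representation B (U g v) v) = cfun.representation B (\<Sum>g\<in>K. U g v) v"
      by (subst cfun.representation_sum) (simp_all add: B(2))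
  qed
  also have "\<dots> = 0"
  proof (intro sum.neutral ballI)
    fix v assume "v \<in> B"
    then have "v \<in> S" using B by blast
    have "(\<Sum>g\<in>K. U g v) = 0"
    proof
      fix x
      \<comment> \<open>The operator \<open>U g\<close> evaluates at the image under
        \<open>inv g\<close>; inversion permutes \<open>K\<close>.\<close>
      have "(\<Sum>g\<in>K. U g v) x = (\<Sum>g\<in>K. v (tmap g x))"
        using sum_perm_group_inv[OF K(1), of "\<lambda>g. v (tmap g x)"] by (simp add: sum_fun_apply U)
      then show "(\<Sum>g\<in>K. U g v) x = 0 x" using zero[OF \<open>v \<in> S\<close>] by simp
    qed
    then show "cfun.representation B (\<Sum>g\<in>K. U g v) v = 0"
      by (simp add: cfun.representation_zero)
  qed
  finally show ?thesis .
qed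

text \<open>The Foulkes character is written as a sum over fixed set partitions. Interchanging the
  two sums leaves, for each set partition, the conjugate of a sum over its stabilizer.\<close>

lemma foulkes_inner_eq_0:
  assumes lam: "int_partition (a * b) lam"
    and vanish: "\<And>P. P \<in> set_parts a b \<Longrightarrow> (\<Sum>g\<in>stab (a * b) P. specht_char lam g) = 0"
  shows "char_inner (a * b) (foulkes_char a b) (specht_char lam) = 0"
proof -
  let ?N = "a * b"
  let ?S = "{g. g permutes {1..?N}}"
  let ?X = "set_parts a b"
  have finS: "finite ?S" by (simp add: finite_permutations)
  have "(\<Sum>g\<in>?S. foulkes_char a b g * cnj (specht_char lam g)) =
      (\<Sum>g\<in>?S. \<Sum>P\<in>?X. if (`) g ` P = P then cnj (specht_char lam g) else 0)"
  proof (intro sum.cong refl)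
    fix g assume "g \<in> ?S"
    then have "foulkes_char a b g = (\<Sum>P\<in>?X. if (`) g ` P = P then 1 else 0)"
      using finite_set_parts by (simp add: foulkes_char_eq sum.If_cases Int_def)
    then show "foulkes_char a b g * cnj (specht_char lam g) =
        (\<Sum>P\<in>?X. if (`) g ` P = P then cnj (specht_char lam g) else 0)"
      by (simp add: sum_distrib_right if_distrib[of "\<lambda>c. c * _"] cong: if_cong)
  qed
  also have "\<dots> = (\<Sum>P\<in>?X. \<Sum>g\<in>?S. if (`) g ` P = P then cnj (specht_char lam g) else 0)"
    by (rule sum.swap)
  also have "\<dots> = (\<Sum>P\<in>?X. cnj (\<Sum>g\<in>stab ?N P. specht_char lam g))"
    using finS by (intro sum.cong refl) (simp add: sum.If_cases Int_def stab_def)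
  also have "\<dots> = 0" using vanish by simp
  finally show ?thesis by (simp add: char_inner_def)
qed

theorem theorem1p2:
  fixes a b k m n :: nat and \<alpha> :: "nat list"
  assumes "a > 0" and "b > 0" and "k > 0" and "m > 0"
    and "int_partition m \<alpha>"
    and "length \<alpha> \<le> k"
    and "int (a * b) - int k - int m \<ge> int (hd \<alpha>) + 1"
    and "n = (\<Sum>j = 2..length \<alpha>. \<alpha> ! (j - 1))"
    and "k > n"
    and "real (hd \<alpha>) < 1 / 2 * (real k - real n) * (real k - real n + 1)"
  shows "char_inner (a * b) (foulkes_char a b) (specht_char (bracket_partition a b k \<alpha>)) = 0"
proof -
  let ?lam = "bracket_partition a b k \<alpha>"
  \<comment> \<open>Since \<open>m > 0\<close>, the partition has a part, so
    \<open>hd \<alpha>\<close> is genuinely its first part.\<close>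
  have ne: "\<alpha> \<noteq> []" using assms by (auto simp: int_partition_def)
  have part: "int_partition (a * b) ?lam"
  proof (rule int_partition_bracket_partition[OF assms(5) ne assms(6)])
    show "k + m + (hd \<alpha> + 1) \<le> a * b" using assms(7) by linarith
  qed
  then have sum: "sum_list ?lam = a * b" by (simp add: int_partition_def)
  have len: "length ?lam = k + 1" using assms by (simp add: bracket_partition_def)
  have lam1: "?lam ! 1 - 1 = hd \<alpha>"
    using ne by (simp add: bracket_partition_def nth_append hd_conv_nth nth_Cons')
  \<comment> \<open>The long first row shifts the indices by one, and the trailing parts equal to 1
    contribute 0.\<close>
  have "(\<Sum>i = 2..<k + 1. ?lam ! i - 1) = (\<Sum>i = 2..<k + 1. if i \<le> length \<alpha> then \<alpha> ! (i - 1) else 0)"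
    using assms(6) by (intro sum.cong refl) (auto simp: bracket_partition_def nth_append nth_Cons')
  also have "\<dots> = n"
    unfolding assms(8) using assms(6) by (intro sum.mono_neutral_cong_right) auto
  finally have n: "n = (\<Sum>i = 2..<length ?lam. ?lam ! i - 1)" by (simp add: len)
  define d where "d = k - n"
  have tri: "2 * \<Sum>{..<q + 1} = q * (q + 1)" for q :: nat by (induction q) auto
  \<comment> \<open>As \<open>k > n\<close>, the real difference equals the natural number
    \<open>d\<close>. The bound then compares \<open>hd \<alpha>\<close> with the sum of
    \<open>{..<d + 1}\<close>, where \<open>d + 1\<close> is the length of the shape minus
    \<open>n\<close>.\<close>
  have "real (2 * hd \<alpha>) < real (d * (d + 1))"
    using assms(9,10) by (simp add: d_def of_nat_diff field_simps)
  then have "hd \<alpha> < \<Sum>{..<d + 1}" using tri[of d] by linarith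
  then have bound: "?lam ! 1 - 1 < \<Sum>{..<length ?lam - n}"
    using assms(9) by (simp add: lam1 len d_def Suc_diff_le)
  show ?thesis
  proof (rule foulkes_inner_eq_0[OF part])
    fix P assume P: "P \<in> set_parts a b"
    show "(\<Sum>g\<in>stab (a * b) P. specht_char ?lam g) = 0"
    proof (rule sum_specht_char_eq_0[OF stab_group])
      show "g permutes {1..sum_list ?lam}" if "g \<in> stab (a * b) P" for g
        using that by (simp add: sum stab_def)
      fix t x assume "tableau ?lam t"
      then interpret young_tableau ?lam t "a * b"
        using part by unfold_locales
      show "(\<Sum>h\<in>stab (a * b) P. polytabloid ?lam t (tmap h x)) = 0"
        by (rule sum_stab_polytabloid[OF refl P _ n _ bound]) (use assms len in auto)
    qed
  qed
qed

end
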